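(* Let $K$ be a field with a nontrivial valuation $\operatorname{val}:K^*\to\mathbb R$ whose value group $\Gamma=\operatorname{val}(K^* )\subseteq\mathbb R$ is dense in $\mathbb R$ and contains $\mathbb Q$, and assume that the valuation admits a splitting. Let $X$ be a subvariety of the algebraic torus $T^n\cong(K^* )^n$. Then there is a finite $\Gamma$-rational polyhedral complex $\Sigma$ in $\mathbb R^n$ whose support $|\Sigma|$ equals $\operatorname{trop}(X)$.
   Context: A splitting of the valuation is a group homomorphism $\Gamma\to K^*$, $w\mapsto t^w$, with $\operatorname{val}(t^w)=w$. For a nonzero Laurent polynomial $f=\sum_{u\in\mathbb Z^n}c_ux^u\in K[x_1^{\pm1},\dots,x_n^{\pm1}]$, let $\operatorname{trop}(f):\mathbb R^n\to\mathbb R$ be $\operatorname{trop}(f)(w)=\min_{u:\,c_u\ne0}(\operatorname{val}(c_u)+w\cdot u)$, and let $\operatorname{trop}(V(f))\subseteq\mathbb R^n$ be its non-linear locus, that is, the set of $w\in\mathbb R^n$ at which the minimum is achieved at least twice; for $f=0$, $\operatorname{trop}(V(f))=\mathbb R^n$. The tropical variety of $X$ is $$\operatorname{trop}(X)=\bigcap_{f\in I(X)}\operatorname{trop}(V(f)),$$ where $I(X)\subseteq K[x_1^{\pm1},\dots,x_n^{\pm1}]$ is the ideal of Laurent polynomials vanishing on $X$. A polyhedral complex is a collection of polyhedra that contains all (nonempty) faces of any polyhedron in the collection and in which the intersection of any two polyhedra is either empty or a common face of both. Its support is the union of its polyhedra. A polyhedron $P\subseteq\mathbb R^n$ is $\Gamma$-rational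 if $P=\{x: Ax\le b\}$ for some matrix $A$ with rational entries, with $s$ rows, and some $b\in\Gamma^s$. A polyhedral complex is $\Gamma$-rational if all its polyhedra are. *)

theory Defs
  imports "HOL-Analysis.Analysis" "HOL-Library.Poly_Mapping"
begin

text \<open>
  A valuation is a total function on the field of which only the values at nonzero
  elements are ever used; its value at 0 is arbitrary.
\<close>

definition valuation :: "('k::field \<Rightarrow> real) \<Rightarrow> bool" where
  "valuation val \<longleftrightarrow>
     (\<forall>a b. a \<noteq> 0 \<longrightarrow> b \<noteq> 0 \<longrightarrow> val (a * b) = val a + val b) \<and>
     (\<forall>a b. a \<noteq> 0 \<longrightarrow> b \<noteq> 0 \<longrightarrow> a + b \<noteq> 0 \<longrightarrow> min (val a) (val b) \<le> val (a + b))"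

definition nontrivial_valuation :: "('k::field \<Rightarrow> real) \<Rightarrow> bool" where
  "nontrivial_valuation val \<longleftrightarrow> valuation val \<and> (\<exists>a. a \<noteq> 0 \<and> val a \<noteq> 0)"

definition value_group :: "('k::field \<Rightarrow> real) \<Rightarrow> real set" where
  "value_group val = val ` (UNIV - {0})"

definition splitting :: "('k::field \<Rightarrow> real) \<Rightarrow> (real \<Rightarrow> 'k) \<Rightarrow> bool" where
  "splitting val t \<longleftrightarrow>
     (\<forall>w\<in>value_group val. t w \<noteq> 0 \<and> val (t w) = w) \<and>
     (\<forall>w\<in>value_group val. \<forall>w'\<in>value_group val. t (w + w') = t w * t w')"

text \<open>
  A Laurent polynomial is a finitely supported map from exponent vectors in
  \<open>\<int>\<^sup>n\<close> to coefficients.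
\<close>

type_synonym ('k, 'n) laurent_poly = "(int ^ 'n) \<Rightarrow>\<^sub>0 'k"

definition torus :: "('k::field ^ 'n) set" where
  "torus = {x. \<forall>i. x $ i \<noteq> 0}"

definition laurent_eval :: "('k::field, 'n::finite) laurent_poly \<Rightarrow> 'k ^ 'n \<Rightarrow> 'k" where
  "laurent_eval f x = (\<Sum>u\<in>Poly_Mapping.keys f. Poly_Mapping.lookup f u * (\<Prod>i\<in>UNIV. (x $ i) powi (u $ i)))"

definition torus_subvariety :: "('k::field ^ 'n::finite) set \<Rightarrow> bool" where
  "torus_subvariety X \<longleftrightarrow>
     (\<exists>S :: ('k, 'n) laurent_poly set. X = {x \<in> torus. \<forall>f\<in>S. laurent_eval f x = 0})"

definition vanishing_ideal :: "('k::field ^ 'n::finite) set \<Rightarrow> ('k, 'n) laurent_poly set" where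
  "vanishing_ideal X = {f. \<forall>x\<in>X. laurent_eval f x = 0}"

definition trop_term ::
    "('k::field \<Rightarrow> real) \<Rightarrow> ('k, 'n::finite) laurent_poly \<Rightarrow> real ^ 'n \<Rightarrow> int ^ 'n \<Rightarrow> real" where
  "trop_term val f w u = val (Poly_Mapping.lookup f u) + w \<bullet> (\<chi> i. real_of_int (u $ i))"

text \<open>Meaningful for nonzero \<open>f\<close> only.\<close>

definition trop_poly ::
    "('k::field \<Rightarrow> real) \<Rightarrow> ('k, 'n::finite) laurent_poly \<Rightarrow> real ^ 'n \<Rightarrow> real" where
  "trop_poly val f w = Min (trop_term val f w ` Poly_Mapping.keys f)"

definition trop_hypersurface ::
    "('k::field \<Rightarrow> real) \<Rightarrow> ('k, 'n::finite) laurent_poly \<Rightarrow> (real ^ 'n) set" where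
  "trop_hypersurface val f =
     (if f = 0 then UNIV
      else {w. \<exists>u\<in>Poly_Mapping.keys f. \<exists>v\<in>Poly_Mapping.keys f. u \<noteq> v \<and>
                 trop_term val f w u = trop_poly val f w \<and>
                 trop_term val f w v = trop_poly val f w})"

definition tropical_variety ::
    "('k::field \<Rightarrow> real) \<Rightarrow> ('k ^ 'n::finite) set \<Rightarrow> (real ^ 'n) set" where
  "tropical_variety val X = (\<Inter>f\<in>vanishing_ideal X. trop_hypersurface val f)"

text \<open>
  The library relation \<open>face_of\<close> also admits the empty set as a face. On polyhedra it
  coincides with the faces cut out by supporting hyperplanes, together with the
  polyhedron itself and the empty set.
\<close>

definition polyhedral_complex :: "(real ^ 'n::finite) set set \<Rightarrow> bool" where
  "polyhedral_complex \<C> \<longleftrightarrow>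
     (\<forall>P\<in>\<C>. polyhedron P) \<and>
     (\<forall>P\<in>\<C>. \<forall>F. F face_of P \<and> F \<noteq> {} \<longrightarrow> F \<in> \<C>) \<and>
     (\<forall>P\<in>\<C>. \<forall>Q\<in>\<C>. P \<inter> Q = {} \<or> (P \<inter> Q face_of P \<and> P \<inter> Q face_of Q))"

text \<open>The rows of the matrix \<open>A\<close> are \<open>A 0, \<dots>, A (s - 1)\<close>.\<close>

definition rational_polyhedron :: "real set \<Rightarrow> (real ^ 'n::finite) set \<Rightarrow> bool" where
  "rational_polyhedron \<Gamma> P \<longleftrightarrow>
     (\<exists>(s::nat) (A :: nat \<Rightarrow> real ^ 'n) (b :: nat \<Rightarrow> real).
        (\<forall>i<s. (\<forall>j. A i $ j \<in> \<rat>) \<and> b i \<in> \<Gamma>) \<and>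
        P = {x. \<forall>i<s. A i \<bullet> x \<le> b i})"

definition rational_complex :: "real set \<Rightarrow> (real ^ 'n::finite) set set \<Rightarrow> bool" where
  "rational_complex \<Gamma> \<C> \<longleftrightarrow> polyhedral_complex \<C> \<and> (\<forall>P\<in>\<C>. rational_polyhedron \<Gamma> P)"

end

theory Submission
  imports Defs "HOL-Library.Diagonal_Subsequence"
begin

text \<open>
  A weight \<open>w\<close> lies outside \<open>trop(X)\<close> iff some \<open>f \<in> I(X)\<close> has a strictly minimal term at \<open>w\<close>,
  and after multiplication by a monomial this is the constant term. Degrees of such \<open>f\<close> can be
  bounded independently of \<open>w\<close>: pull \<open>I(X)\<close> back to homogeneous polynomials in variables
  for \<open>x\<^sub>i\<close>, \<open>x\<^sub>i\<^sup>-\<^sup>1\<close> and a homogenising variable \<open>z\<close> mapped to 1, and break ties between terms of equal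
  weight by a lexicographic order in which \<open>z\<close> is smallest. The leading monomials for \<open>w\<close> form
  a monomial ideal whose Hilbert function does not depend on \<open>w\<close>. By Dickson's lemma
  and compactness, there is a bound \<open>D\<close> such that each of these ideals that contains a power of \<open>z\<close>
  contains one of degree at most \<open>D\<close>, and a power of \<open>z\<close> is leading iff it is strictly minimal.

  In the resulting finite-dimensional space of Laurent polynomials, those of minimal support
  suffice, and there are finitely many of them up to scaling. Hence \<open>trop(X)\<close> is a finite
  intersection of tropical hypersurfaces. It is therefore a union of cells of the
  arrangement of the hyperplanes on which two terms of one of these polynomials have equal weight.
\<close>

section \<open>Strict minima over a valued field\<close>

definition linear_closed :: "('a \<Rightarrow> 'k::field) set \<Rightarrow> bool" where
  "linear_closed V \<longleftrightarrow> (\<lambda>_. 0) \<in> V \<and> (\<forall>f\<in>V. \<forall>g\<in>V. \<forall>c. (\<lambda>x. f x + c * g x) \<in> V)"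

lemma linear_closed_sum:
  assumes "linear_closed V" "finite A" "\<And>a. a \<in> A \<Longrightarrow> g a \<in> V"
  shows "(\<lambda>x. \<Sum>a\<in>A. c a * g a x) \<in> V"
  using assms(2,3)
proof (induction A rule: finite_induct)
  case empty
  then show ?case using assms(1) by (simp add: linear_closed_def)
next
  case (insert a A)
  then have "(\<lambda>x. (\<Sum>a\<in>A. c a * g a x) + c a * g a x) \<in> V"
    using assms(1) unfolding linear_closed_def by auto
  then show ?case using insert by (simp add: add.commute)
qed

text \<open>Gaussian elimination with the \<open>c a\<close> as unknowns: a pivot \<open>p\<close>
  removes one equation and one unknown, so unknowns stay in excess.\<close>

lemma homogeneous_system_nontrivial_solution:
  fixes g :: "'a \<Rightarrow> 'b \<Rightarrow> 'k::field"
  assumes "finite B" "finite A" "card B < card A"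
  shows "\<exists>c. (\<exists>a\<in>A. c a \<noteq> 0) \<and> (\<forall>b\<in>B. (\<Sum>a\<in>A. c a * g a b) = 0)"
  using assms
proof (induction B arbitrary: A g rule: finite_induct)
  case empty
  then have "A \<noteq> {}" by auto
  then show ?case by (intro exI[of _ "\<lambda>_. 1"]) auto
next
  case (insert b B)
  show ?case
  proof (cases "\<exists>p\<in>A. g p b \<noteq> 0")
    case False
    have "card B < card A" using insert by simp
    from insert.IH[OF insert.prems(1) this, of g] False show ?thesis by fastforce
  next
    case True
    then obtain p where p: "p \<in> A" "g p b \<noteq> 0" by blast
    \<comment> \<open>Subtracting this multiple of the pivot column makes equation \<open>b\<close>
      trivial, so only the equations in \<open>B\<close> remain for the induction
      hypothesis.\<close>
    define g' where "g' = (\<lambda>a x. g a x - g a b / g p b * g p x)"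
    have "card B < card (A - {p})" using insert p by simp
    from insert.IH[OF _ this, of g'] insert.prems(1) obtain c where
      c: "\<exists>a\<in>A - {p}. c a \<noteq> 0" "\<forall>x\<in>B. (\<Sum>a\<in>A - {p}. c a * g' a x) = 0" by auto
    \<comment> \<open>Equation \<open>b\<close> forces the value \<open>- s\<close> on the pivot
      unknown.\<close>
    define s where "s = (\<Sum>a\<in>A - {p}. c a * (g a b / g p b))"
    define c' where "c' = c(p := - s)"
    have eq: "(\<Sum>a\<in>A. c' a * g a x) = (\<Sum>a\<in>A - {p}. c a * g' a x)" for x
    proof -
      have "(\<Sum>a\<in>A. c' a * g a x) = - s * g p x + (\<Sum>a\<in>A - {p}. c a * g a x)"
        using p insert.prems(1) by (simp add: sum.remove[of A p] c'_def)
      also have "\<dots> = (\<Sum>a\<in>A - {p}. c a * g' a x)"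
        by (simp add: g'_def s_def algebra_simps sum_subtractf sum_distrib_left)
      finally show ?thesis .
    qed
    have "g' a b = 0" for a using p by (simp add: g'_def)
    then have "\<forall>x\<in>insert b B. (\<Sum>a\<in>A. c' a * g a x) = 0"
      using c(2) by (simp add: eq)
    moreover have "\<exists>a\<in>A. c' a \<noteq> 0" using c(1) by (auto simp: c'_def)
    ultimately show ?thesis by blast
  qed
qed

section \<open>Ultrametric arithmetic and leading positions\<close>

locale valued_field =
  fixes val :: "'k::field \<Rightarrow> real"
  assumes valuation: "valuation val"
begin

lemma val_mult: "a \<noteq> 0 \<Longrightarrow> b \<noteq> 0 \<Longrightarrow> val (a * b) = val a + val b"
  using valuation by (simp add: valuation_def)

lemma val_add_ge: "a \<noteq> 0 \<Longrightarrow> b \<noteq> 0 \<Longrightarrow> a + b \<noteq> 0 \<Longrightarrow> min (val a) (val b) \<le> val (a + b)"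
  using valuation by (simp add: valuation_def)

lemma val_one: "val 1 = 0"
  using val_mult[of 1 1] by simp

lemma val_minus: "a \<noteq> 0 \<Longrightarrow> val (- a) = val a"
  using val_mult[of "-1" "-1"] val_mult[of "-1" a] val_one by simp

lemma val_divide: "a \<noteq> 0 \<Longrightarrow> b \<noteq> 0 \<Longrightarrow> val (a / b) = val a - val b"
  using val_mult[of "a / b" b] by simp

text \<open>Zero counts as having infinite valuation, since \<open>val 0\<close> is
  arbitrary.\<close>

definition above :: "real \<Rightarrow> 'k \<Rightarrow> bool" where
  "above c x \<longleftrightarrow> x = 0 \<or> c < val x"

lemma above_0 [simp]: "above c 0"
  by (simp add: above_def)

lemma above_add: "above c x \<Longrightarrow> above c y \<Longrightarrow> above c (x + y)"
  using val_add_ge[of x y] unfolding above_def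
  by (cases "x = 0"; cases "y = 0"; cases "x + y = 0") auto

lemma above_sum: "(\<And>a. a \<in> A \<Longrightarrow> above c (f a)) \<Longrightarrow> above c (\<Sum>a\<in>A. f a)"
  by (induction A rule: infinite_finite_induct) (auto intro: above_add)

lemma above_minus: "above c x \<Longrightarrow> above c (- x)"
  using val_minus[of x] by (cases "x = 0") (auto simp: above_def)

lemma val_add_above:
  assumes "x \<noteq> 0" "above (val x) y"
  shows "x + y \<noteq> 0" "val (x + y) = val x"
proof -
  show nz: "x + y \<noteq> 0"
  proof
    assume "x + y = 0"
    then have "y = - x" by (simp add: add_eq_0_iff)
    then show False using assms val_minus[of x] by (simp add: above_def)
  qed
  show "val (x + y) = val x"
  proof (cases "y = 0")
    case False
    then have "val x < val y" using assms by (simp add: above_def)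
    moreover have "min (val x) (val y) \<le> val (x + y)"
      using assms False nz by (intro val_add_ge)
    \<comment> \<open>Recovering x as (x + y) - y bounds \<open>val (x + y)\<close> from above,
      because \<open>val y\<close> is too large to be the minimum.\<close>
    moreover have "min (val (x + y)) (val (- y)) \<le> val (x + y + - y)"
      using assms False nz by (intro val_add_ge) auto
    ultimately show ?thesis using val_minus[OF False] by simp
  qed simp
qed

text \<open>The inequality between the weighted terms at e and m is solved for
  \<open>val (f m)\<close>, so that \<open>above\<close> takes care of zero coefficients.\<close>

definition strict_min :: "('a \<Rightarrow> real) \<Rightarrow> ('a \<Rightarrow> 'k) \<Rightarrow> 'a \<Rightarrow> bool" where
  "strict_min \<omega> f e \<longleftrightarrow> f e \<noteq> 0 \<and> (\<forall>m. m \<noteq> e \<longrightarrow> above (val (f e) + \<omega> e - \<omega> m) (f m))"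

text \<open>
  Ties go to the larger monomial: a power of the homogenising variable, which is the smallest
  monomial of its degree, is then leading only if it attains the minimum alone.
\<close>

definition lead :: "('a::linorder \<Rightarrow> real) \<Rightarrow> ('a \<Rightarrow> 'k) \<Rightarrow> 'a \<Rightarrow> bool" where
  "lead \<omega> f e \<longleftrightarrow> f e \<noteq> 0 \<and>
     (\<forall>m. m \<noteq> e \<longrightarrow> f m \<noteq> 0 \<longrightarrow> val (f e) + \<omega> e < val (f m) + \<omega> m \<or>
        val (f e) + \<omega> e = val (f m) + \<omega> m \<and> m < e)"

definition leads :: "('a::linorder \<Rightarrow> real) \<Rightarrow> ('a \<Rightarrow> 'k) set \<Rightarrow> 'a set" where
  "leads \<omega> V = {e. \<exists>f\<in>V. lead \<omega> f e}"

lemma lead_exists: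
  fixes f :: "'a::linorder \<Rightarrow> 'k"
  assumes fin: "finite {m. f m \<noteq> 0}" and nz: "f x \<noteq> 0"
  shows "\<exists>e. lead \<omega> f e"
proof -
  define S where "S = {m. f m \<noteq> 0}"
  define r where "r = Min ((\<lambda>m. val (f m) + \<omega> m) ` S)"
  define T where "T = {m \<in> S. val (f m) + \<omega> m = r}"
  have S: "finite S" "S \<noteq> {}" using fin nz by (auto simp: S_def)
  have "r \<in> (\<lambda>m. val (f m) + \<omega> m) ` S" unfolding r_def using S by (intro Min_in) auto
  then have T: "finite T" "T \<noteq> {}" using S by (auto simp: T_def)
  have le: "r \<le> val (f m) + \<omega> m" if "m \<in> S" for m
    unfolding r_def using that S by (intro Min_le) auto
  have "Max T \<in> T" using T by (rule Max_in)
  moreover have "m \<le> Max T" if "m \<in> T" for m using T that by simp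
  ultimately have *: "f (Max T) \<noteq> 0" "val (f (Max T)) + \<omega> (Max T) = r"
      "\<And>m. m \<in> S \<Longrightarrow> val (f m) + \<omega> m = r \<Longrightarrow> m \<le> Max T"
    by (auto simp: T_def S_def)
  have "lead \<omega> f (Max T)"
    unfolding lead_def
  proof (intro conjI allI impI *(1))
    fix m assume m: "m \<noteq> Max T" "f m \<noteq> 0"
    then have "m \<in> S" by (simp add: S_def)
    then show "val (f (Max T)) + \<omega> (Max T) < val (f m) + \<omega> m \<or>
        val (f (Max T)) + \<omega> (Max T) = val (f m) + \<omega> m \<and> m < Max T"
      using le[of m] *(2) *(3)[of m] m(1) by (cases "val (f m) + \<omega> m = r") auto
  qed
  then show ?thesis ..
qed

text \<open>
  Vectors with distinct leading positions are linearly independent, and a vector vanishing on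
  all leading positions is zero; so both cardinalities are the dimension of \<open>V\<close>.
\<close>

lemma card_leads_le:
  fixes V :: "('a::linorder \<Rightarrow> 'k) set"
  assumes V: "linear_closed V" and E: "finite E" "\<And>f m. f \<in> V \<Longrightarrow> f m \<noteq> 0 \<Longrightarrow> m \<in> E"
  shows "card (leads \<omega> V) \<le> card (leads \<omega>' V)"
proof (rule ccontr)
  define A where "A = leads \<omega> V"
  define B where "B = leads \<omega>' V"
  assume "\<not> ?thesis"
  then have less: "card B < card A" by (simp add: A_def B_def)
  have "A \<subseteq> E" "B \<subseteq> E" using E(2) by (auto simp: A_def B_def leads_def lead_def)
  then have fin: "finite A" "finite B" using E(1) finite_subset by blast+
  have "\<forall>a\<in>A. \<exists>f\<in>V. lead \<omega> f a" by (auto simp: A_def leads_def)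
  then obtain g where g: "\<And>a. a \<in> A \<Longrightarrow> g a \<in> V" "\<And>a. a \<in> A \<Longrightarrow> lead \<omega> (g a) a" by metis
  \<comment> \<open>There are more vectors \<open>g a\<close> than positions in \<open>B\<close>, so
    a nontrivial combination of them vanishes on \<open>B\<close>. The contradiction will be that
    this combination is nonzero.\<close>
  obtain c where c: "\<exists>a\<in>A. c a \<noteq> 0" "\<forall>b\<in>B. (\<Sum>a\<in>A. c a * g a b) = 0"
    using homogeneous_system_nontrivial_solution[OF fin(2,1) less] by blast
  define h where "h = (\<lambda>x. \<Sum>a\<in>A. c a * g a x)"
  have hV: "h \<in> V" unfolding h_def using V fin(1) g(1) by (rule linear_closed_sum)
  have finh: "finite {m. h m \<noteq> 0}" 
    by (rule finite_subset[OF _ E(1)]) (use E(2)[OF hV] in auto)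
  \<comment> \<open>\<open>c' a\<close> is the contribution of \<open>g a\<close> at its own leading
    position. At the leading position e of \<open>c'\<close>, the term from \<open>g e\<close>
    strictly dominates all others in \<open>h e\<close>, so nothing cancels it.\<close>
  define c' where "c' = (\<lambda>a. if a \<in> A then c a * g a a else 0)"
  obtain a0 where "a0 \<in> A" "c a0 \<noteq> 0" using c by blast
  moreover have gaa: "g a a \<noteq> 0" if "a \<in> A" for a using g(2)[OF that] by (simp add: lead_def)
  ultimately have "c' a0 \<noteq> 0" by (simp add: c'_def)
  moreover have "finite {m. c' m \<noteq> 0}" using fin(1) by (auto simp: c'_def)
  ultimately obtain e where e: "lead \<omega> c' e" using lead_exists by blast
  then have eA: "e \<in> A" and nze: "c' e \<noteq> 0" by (auto simp: lead_def c'_def split: if_splits)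
  have "above (val (c' e)) (c a * g a e)" if a: "a \<in> A - {e}" for a
  proof (cases "c a = 0 \<or> g a e = 0")
    case False
    then have nz: "c a \<noteq> 0" "g a e \<noteq> 0" by auto
    have c'a: "c' a \<noteq> 0" "val (c' a) = val (c a) + val (g a a)" using nz a gaa[of a]
      by (auto simp: c'_def val_mult)
    have 1: "val (g a a) + \<omega> a < val (g a e) + \<omega> e \<or> val (g a a) + \<omega> a = val (g a e) + \<omega> e \<and> e < a"
      using g(2)[of a] a nz(2) unfolding lead_def by auto
    have 2: "val (c' e) + \<omega> e < val (c' a) + \<omega> a \<or> val (c' e) + \<omega> e = val (c' a) + \<omega> a \<and> a < e"
      using e a c'a(1) unfolding lead_def by auto
    \<comment> \<open>A tie in \<open>1\<close> gives \<open>e < a\<close> and a tie in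
      \<open>2\<close> gives \<open>a < e\<close>, so at least one of the two inequalities is
      strict.\<close>
    have "val (c' e) < val (c a) + val (g a e)" using 1 2 c'a(2) by auto
    then show ?thesis using nz by (simp add: above_def val_mult)
  qed auto
  then have "above (val (c' e)) (\<Sum>a\<in>A - {e}. c a * g a e)" by (rule above_sum)
  moreover have "h e = c' e + (\<Sum>a\<in>A - {e}. c a * g a e)"
    using eA fin(1) by (simp add: h_def c'_def sum.remove)
  ultimately have "h e \<noteq> 0" using val_add_above(1)[OF nze] by simp
  then obtain b where b: "lead \<omega>' h b" using lead_exists finh by blast
  then have "b \<in> B" using hV by (auto simp: B_def leads_def)
  then have "h b = 0" using c(2) by (simp add: h_def)
  then show False using b by (simp add: lead_def)
qed

text \<open>\<open>C\<close> holds one vector for each support occurring in \<open>V\<close>, and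
  supports are subsets of the finite \<open>E\<close>. Vectors with the same minimal nonempty
  support are proportional and so have the same strict minima; any other vector is reduced to one of
  smaller support with a strict minimum at the same place.\<close>

lemma finite_circuit_set:
  fixes V :: "('a \<Rightarrow> 'k) set"
  assumes V: "linear_closed V" and E: "finite E" "\<And>f m. f \<in> V \<Longrightarrow> f m \<noteq> 0 \<Longrightarrow> m \<in> E"
  shows "\<exists>C\<subseteq>V. finite C \<and> (\<forall>\<omega> u f. f \<in> V \<and> strict_min \<omega> f u \<longrightarrow> (\<exists>g\<in>C. strict_min \<omega> g u))"
proof -
  define supp :: "('a \<Rightarrow> 'k) \<Rightarrow> 'a set" where "supp = (\<lambda>f. {m. f m \<noteq> 0})"
  have suppE: "supp f \<subseteq> E" if "f \<in> V" for f using E(2)[OF that] by (auto simp: supp_def)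
  have finsupp: "finite (supp f)" if "f \<in> V" for f using suppE[OF that] E(1) finite_subset by blast
  define pick where "pick = (\<lambda>S. SOME f. f \<in> V \<and> supp f = S)"
  define C where "C = pick ` (supp ` V)"
  have pick: "pick (supp f) \<in> V" "supp (pick (supp f)) = supp f" if "f \<in> V" for f
    using someI[of "\<lambda>g. g \<in> V \<and> supp g = supp f" f] that by (auto simp: pick_def)
  have diff: "(\<lambda>x. f x - c * g x) \<in> V" if "f \<in> V" "g \<in> V" for f g c
  proof -
    have "(\<lambda>x. f x + (- c) * g x) \<in> V" using V that unfolding linear_closed_def by blast
    then show ?thesis by simp
  qed
  have "C \<subseteq> V" using pick by (auto simp: C_def)
  moreover have "finite C"
  proof -
    have "supp ` V \<subseteq> Pow E" using suppE by auto
    then show ?thesis unfolding C_def using E(1) by (meson finite_Pow_iff finite_imageI finite_subset)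
  qed
  moreover have "\<exists>g\<in>C. strict_min \<omega> g u" if "f \<in> V" "strict_min \<omega> f u" for \<omega> u f
    using that
  proof (induction "card (supp f)" arbitrary: f rule: less_induct)
    case less
    note f = less.prems
    have fu: "f u \<noteq> 0" using f by (simp add: strict_min_def)
    have fmin: "val (f u) + \<omega> u < val (f m) + \<omega> m" if "m \<noteq> u" "f m \<noteq> 0" for m
      using f(2) that by (auto simp: strict_min_def above_def)
    show ?case
      \<comment> \<open>Given \<open>g\<close> of smaller support, cancel a position minimising \<open>val (g m) - val (f m)\<close>:
         no valuation of \<open>f\<close> drops, unless \<open>u\<close> itself is minimising, and then \<open>g\<close> already works.\<close>
    proof (cases "\<exists>g\<in>V. supp g \<noteq> {} \<and> supp g \<subset> supp f")
      case False
      define g where "g = pick (supp f)"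
      have g: "g \<in> V" "supp g = supp f" using pick[OF f(1)] by (auto simp: g_def)
      have gu: "g u \<noteq> 0" using fu g(2) by (auto simp: supp_def)
      define c where "c = f u / g u"
      have c: "c \<noteq> 0" using fu gu by (simp add: c_def)
      \<comment> \<open>Position u is cancelled, so the support shrinks and, by minimality, is
        empty: f is a multiple of its representative g.\<close>
      define h where "h = (\<lambda>x. f x - c * g x)"
      have "h \<in> V" unfolding h_def using diff f g by blast
      moreover have "supp h \<subset> supp f"
      proof -
        have "h u = 0" using gu by (simp add: h_def c_def)
        moreover have "f m \<noteq> 0" if "h m \<noteq> 0" for m
        proof
          assume "f m = 0"
          then have "m \<notin> supp g" unfolding g(2) by (simp add: supp_def)
          then show False using that \<open>f m = 0\<close> by (simp add: h_def supp_def)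
        qed
        then have "supp h \<subseteq> supp f" by (auto simp: supp_def)
        ultimately show ?thesis using fu by (auto simp: supp_def)
      qed
      ultimately have "supp h = {}" using False by blast
      then have feq: "f x = c * g x" for x by (auto simp: supp_def h_def)
      have "strict_min \<omega> g u" unfolding strict_min_def above_def
      proof (intro conjI allI impI gu)
        fix m assume m: "m \<noteq> u"
        show "g m = 0 \<or> val (g u) + \<omega> u - \<omega> m < val (g m)"
        proof (cases "g m = 0")
          case False
          then show ?thesis using fmin[OF m] c gu by (auto simp: feq val_mult)
        qed auto
      qed
      moreover have "g \<in> C" using f by (auto simp: C_def g_def)
      ultimately show ?thesis by blast
    next
      case True
      then obtain g where g: "g \<in> V" "supp g \<noteq> {}" "supp g \<subset> supp f" by blast
      define q where "q = (\<lambda>m. val (g m) - val (f m))"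
      have fing: "finite (supp g)" using finsupp g by blast
      have gf: "f m \<noteq> 0" if "g m \<noteq> 0" for m using g(3) that by (auto simp: supp_def)
      have card: "card (supp g) < card (supp f)" using g(3) finsupp[OF f(1)] psubset_card_mono by blast
      have "Min (q ` supp g) \<in> q ` supp g" using fing g(2) by (intro Min_in) auto
      then obtain v where "v \<in> supp g" "q v = Min (q ` supp g)" by auto
      then have v: "v \<in> supp g" "\<And>m. m \<in> supp g \<Longrightarrow> q v \<le> q m" using fing by auto
      have gv: "g v \<noteq> 0" using v by (simp add: supp_def)
      show ?thesis
      proof (cases "g u \<noteq> 0 \<and> q u \<le> q v")
        case True
        have "strict_min \<omega> g u" unfolding strict_min_def above_def
        proof (intro conjI allI impI)
          show "g u \<noteq> 0" using True by simp
          fix m assume m: "m \<noteq> u"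
          show "g m = 0 \<or> val (g u) + \<omega> u - \<omega> m < val (g m)"
          proof (cases "g m = 0")
            case False
            then have "q u \<le> q m" using True v(2)[of m] by (simp add: supp_def)
            then show ?thesis using fmin[OF m gf[OF False]] by (simp add: q_def)
          qed auto
        qed
        then show ?thesis using less.hyps[OF card g(1)] by blast
      next
        case False
        have vu: "v \<noteq> u" using False v by (auto simp: supp_def)
        define c where "c = f v / g v"
        have c: "c \<noteq> 0" "val c = - q v" using gv gf[OF gv] by (auto simp: c_def val_divide q_def)
        define h where "h = (\<lambda>x. f x - c * g x)"
        have hV: "h \<in> V" unfolding h_def using diff f g by blast
        have hu: "h u \<noteq> 0" "val (h u) = val (f u)"
        proof -
          have "above (val (f u)) (- (c * g u))"
          proof (cases "g u = 0")
            case False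
            then have "val (c * g u) = - q v + q u + val (f u)" using c by (simp add: val_mult q_def)
            moreover have "q v < q u" using False \<open>\<not> (g u \<noteq> 0 \<and> q u \<le> q v)\<close> by simp
            ultimately show ?thesis by (intro above_minus) (simp add: above_def)
          qed simp
          from val_add_above[OF fu this] show "h u \<noteq> 0" "val (h u) = val (f u)" by (auto simp: h_def)
        qed
        have "strict_min \<omega> h u" unfolding strict_min_def
        proof (intro conjI allI impI hu(1))
          fix m assume m: "m \<noteq> u"
          let ?c = "val (h u) + \<omega> u - \<omega> m"
          have "above ?c (f m)" using fmin[OF m] hu by (cases "f m = 0") (auto simp: above_def)
          moreover have "above ?c (- (c * g m))"
          proof (cases "g m = 0")
            case False
            then have "val (c * g m) = - q v + q m + val (f m)" using c by (simp add: val_mult q_def)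
            moreover have "q v \<le> q m" using v(2) False by (simp add: supp_def)
            ultimately show ?thesis using fmin[OF m gf[OF False]] hu
              by (intro above_minus) (simp add: above_def)
          qed simp
          ultimately show "above ?c (h m)" using above_add unfolding h_def by fastforce
        qed
        moreover have "supp h \<subset> supp f"
        proof -
          have "h v = 0" using gv by (simp add: h_def c_def)
          moreover have "supp h \<subseteq> supp f" using gf unfolding supp_def h_def by auto
          ultimately show ?thesis using gf[OF gv] by (auto simp: supp_def)
        qed
        then have "card (supp h) < card (supp f)" using finsupp[OF f(1)] psubset_card_mono by blast
        ultimately show ?thesis using less.hyps hV by blast
      qed
    qed
  qed
  ultimately show ?thesis by blast
qed

end

section \<open>A uniform degree bound\<close>

text \<open>Of the variables \<open>0, \<dots>, N\<close> the last one is the homogenising variable.\<close>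

definition Mon :: "nat \<Rightarrow> nat \<Rightarrow> (nat \<Rightarrow>\<^sub>0 nat) set" where
  "Mon N d = {m. Poly_Mapping.keys m \<subseteq> {..N} \<and> (\<Sum>i\<le>N. Poly_Mapping.lookup m i) = d}"

lemma finite_Mon: "finite (Mon N d)"
proof (rule finite_imageD)
  have "Poly_Mapping.lookup m i \<le> d" if "m \<in> Mon N d" "i \<le> N" for m i
    using member_le_sum[of i "{..N}" "Poly_Mapping.lookup m"] that by (auto simp: Mon_def)
  moreover have "Poly_Mapping.lookup m i = 0" if "m \<in> Mon N d" "\<not> i \<le> N" for m i
    using that by (auto simp: Mon_def in_keys_iff)
  ultimately have "Poly_Mapping.lookup ` Mon N d \<subseteq>
      {f. \<forall>i. (i \<in> {..N} \<longrightarrow> f i \<in> {..d}) \<and> (i \<notin> {..N} \<longrightarrow> f i = 0)}"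
    by (simp add: image_subset_iff)
  moreover have "finite {f :: nat \<Rightarrow> nat. \<forall>i. (i \<in> {..N} \<longrightarrow> f i \<in> {..d}) \<and> (i \<notin> {..N} \<longrightarrow> f i = 0)}"
    by (intro finite_set_of_finite_funs) auto
  ultimately show "finite (Poly_Mapping.lookup ` Mon N d)" by (rule finite_subset)
  show "inj_on Poly_Mapping.lookup (Mon N d)" by (intro inj_onI poly_mapping_eqI) metis
qed

lemma Mon_add:
  assumes "m \<in> Mon N d" "s \<in> Mon N j"
  shows "m + s \<in> Mon N (d + j)"
  using assms keys_add[of m s] by (auto simp: Mon_def lookup_add sum.distrib)

lemma single_Mon: "Poly_Mapping.single N d \<in> Mon N d"
proof -
  have "(\<Sum>i\<le>N. Poly_Mapping.lookup (Poly_Mapping.single N d) i) = (\<Sum>i\<le>N. if i = N then d else 0)"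
    by (intro sum.cong) (auto simp: lookup_single)
  then show ?thesis by (auto simp: Mon_def)
qed

text \<open>Monomials are compared at the first index where they differ. A monomial of degree d
  other than the power of the last variable has a positive exponent before index N, where that power
  has exponent 0.\<close>

lemma single_less_Mon:
  assumes m: "m \<in> Mon N d" "m \<noteq> Poly_Mapping.single N d"
  shows "Poly_Mapping.single N d < m"
proof -
  have "\<exists>k<N. Poly_Mapping.lookup m k \<noteq> 0"
  proof (rule ccontr)
    assume *: "\<not> ?thesis"
    have "Poly_Mapping.lookup m i = Poly_Mapping.lookup (Poly_Mapping.single N d) i" for i
    proof -
      consider "i < N" | "i = N" | "i > N" by linarith
      then show ?thesis
      proof cases
        case 2
        have "d = (\<Sum>i\<in>{..N} - {N}. Poly_Mapping.lookup m i) + Poly_Mapping.lookup m N"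
          using m(1) by (simp add: Mon_def sum.remove[of "{..N}" N])
        moreover have "(\<Sum>i\<in>{..N} - {N}. Poly_Mapping.lookup m i) = 0"
          using * by (intro sum.neutral) auto
        ultimately show ?thesis using 2 by simp
      next
        case 3
        then have "i \<notin> Poly_Mapping.keys m" using m(1) by (auto simp: Mon_def)
        then show ?thesis using 3 by (simp add: lookup_single in_keys_iff)
      qed (use * in \<open>auto simp: lookup_single\<close>)
    qed
    then show False using m(2) poly_mapping_eqI by blast
  qed
  then obtain k0 where k0: "k0 < N" "Poly_Mapping.lookup m k0 \<noteq> 0" by blast
  define k where "k = (LEAST k. Poly_Mapping.lookup m k \<noteq> 0)"
  have k: "Poly_Mapping.lookup m k \<noteq> 0" "k \<le> k0"
    unfolding k_def using k0(2) by (rule LeastI, intro Least_le)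
  have "Poly_Mapping.lookup m k' = 0" if "k' < k" for k'
    using not_less_Least that unfolding k_def by blast
  then show ?thesis using k k0(1)
    unfolding less_poly_mapping.rep_eq less_fun_def by (intro exI[of _ k]) (auto simp: lookup_single)
qed

lemma Mon_diff:
  assumes "m \<in> Mon N d" "m' \<in> Mon N d'" "\<And>i. i \<le> N \<Longrightarrow> Poly_Mapping.lookup m' i \<le> Poly_Mapping.lookup m i"
  shows "d' \<le> d" "\<exists>s\<in>Mon N (d - d'). m = m' + s"
proof -
  have le: "Poly_Mapping.lookup m' i \<le> Poly_Mapping.lookup m i" for i
  proof (cases "i \<le> N")
    case False
    then have "i \<notin> Poly_Mapping.keys m'" using assms(2) by (auto simp: Mon_def)
    then show ?thesis by (simp add: in_keys_iff)
  qed (use assms(3) in blast)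
  show dd: "d' \<le> d" using assms(1,2) le by (auto simp: Mon_def intro: sum_mono)
  \<comment> \<open>The subtraction of exponents is truncated, but exact by
    \<open>le\<close>.\<close>
  define s where "s = m - m'"
  have m: "m = m' + s" by (rule poly_mapping_eqI) (simp add: s_def lookup_add lookup_minus le)
  moreover have "s \<in> Mon N (d - d')"
  proof -
    have "i \<in> Poly_Mapping.keys m" if "i \<in> Poly_Mapping.keys s" for i
      using that le[of i] by (auto simp: s_def in_keys_iff lookup_minus)
    moreover have "d = d' + (\<Sum>i\<le>N. Poly_Mapping.lookup s i)"
      using assms(1,2) by (simp add: m Mon_def lookup_add sum.distrib)
    ultimately show ?thesis using assms(1) by (auto simp: Mon_def)
  qed
  ultimately show "\<exists>s\<in>Mon N (d - d'). m = m' + s" by blast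
qed

section \<open>Dickson's lemma and Hilbert functions\<close>

lemma incseq_subsequence:
  fixes f :: "nat \<Rightarrow> nat"
  shows "\<exists>r. strict_mono r \<and> incseq (f \<circ> r)"
proof -
  obtain g where g: "strict_mono g" "monoseq (\<lambda>n. f (g n))" using seq_monosub by blast
  show ?thesis
  proof (cases "incseq (\<lambda>n. f (g n))")
    case True
    then show ?thesis using g(1) by (auto simp: o_def)
  next
    case False
    then have dec: "decseq (\<lambda>n. f (g n))" using g(2) by (simp add: monoseq_iff)
    \<comment> \<open>A decreasing sequence of naturals is constant once it has reached its least
      value.\<close>
    obtain k where k: "\<And>i. f (g k) \<le> f (g i)"
      using ex_has_least_nat[of "\<lambda>_. True" 0 "\<lambda>i. f (g i)"] by auto
    have eq: "f (g (i + k)) = f (g k)" for i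
      using decseqD[OF dec, of k "i + k"] k[of "i + k"] by simp
    have "strict_mono (\<lambda>i. g (i + k))" using g(1) by (simp add: strict_mono_def)
    moreover have "incseq (f \<circ> (\<lambda>i. g (i + k)))" by (simp add: incseq_def eq)
    ultimately show ?thesis by blast
  qed
qed

text \<open>Coordinates are treated one after another; those already monotone stay so along a
  further subsequence.\<close>

lemma incseq_subsequence_coordinates:
  fixes f :: "nat \<Rightarrow> nat \<Rightarrow> nat"
  shows "\<exists>r. strict_mono r \<and> (\<forall>c<N. incseq (\<lambda>i. f (r i) c))"
proof (induction N)
  case 0
  then show ?case by (intro exI[of _ id]) (auto simp: strict_mono_def)
next
  case (Suc N)
  then obtain r where r: "strict_mono r" "\<And>c. c < N \<Longrightarrow> incseq (\<lambda>i. f (r i) c)" by blast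
  obtain q where q: "strict_mono q" "incseq ((\<lambda>i. f (r i) N) \<circ> q)" using incseq_subsequence by blast
  have "incseq (\<lambda>i. f ((r \<circ> q) i) c)" if "c < Suc N" for c
  proof (cases "c = N")
    case True
    then show ?thesis using q(2) by (simp add: o_def)
  next
    case False
    then have "incseq (\<lambda>i. f (r i) c)" using r(2) that by simp
    then show ?thesis using strict_mono_less_eq[OF q(1)] by (auto simp: incseq_def)
  qed
  then show ?case using strict_mono_o[OF r(1) q(1)] by blast
qed

text \<open>Finite generation, stated as a bound on the degrees of generators. Without a bound, each
  i yields an element \<open>e i\<close> divisible by no element of degree at most i; along a
  subsequence with all exponents increasing, the first element divides every later one.\<close>

lemma dickson:
  fixes L :: "nat \<Rightarrow> (nat \<Rightarrow>\<^sub>0 nat) set"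
  assumes L: "\<And>d. L d \<subseteq> Mon N d"
  shows "\<exists>d0. \<forall>d. \<forall>e\<in>L d. \<exists>d'\<le>d0. d' \<le> d \<and> (\<exists>e'\<in>L d'. \<exists>s\<in>Mon N (d - d'). e = e' + s)"
proof (rule ccontr)
  assume "\<not> ?thesis"
  then have "\<forall>d0. \<exists>d e. e \<in> L d \<and> \<not> (\<exists>d'\<le>d0. d' \<le> d \<and> (\<exists>e'\<in>L d'. \<exists>s\<in>Mon N (d - d'). e = e' + s))"
    by blast
  then obtain d e where e: "\<And>i. e i \<in> L (d i)"
    and bad: "\<And>i d' e' s. d' \<le> i \<Longrightarrow> d' \<le> d i \<Longrightarrow> e' \<in> L d' \<Longrightarrow> s \<in> Mon N (d i - d') \<Longrightarrow> e i \<noteq> e' + s"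
    by metis
  obtain r where r: "strict_mono r" "\<And>c. c < Suc N \<Longrightarrow> incseq (\<lambda>i. Poly_Mapping.lookup (e (r i)) c)"
    using incseq_subsequence_coordinates[of "Suc N" "\<lambda>i. Poly_Mapping.lookup (e i)"] by blast
  \<comment> \<open>The first element has degree j, and \<open>j \<le> r j\<close>, so it is among
    the divisors forbidden for \<open>e (r j)\<close>.\<close>
  define j where "j = d (r 0)"
  have le: "Poly_Mapping.lookup (e (r 0)) i \<le> Poly_Mapping.lookup (e (r j)) i" if "i \<le> N" for i
    using incseqD[OF r(2), of i 0 j] that by simp
  have "j \<le> r j" using r(1) by (rule strict_mono_imp_increasing)
  moreover have "e (r 0) \<in> L j" unfolding j_def by (rule e)
  moreover have mm: "e (r j) \<in> Mon N (d (r j))" "e (r 0) \<in> Mon N j" using e L unfolding j_def by blast+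
  moreover have "j \<le> d (r j)" using mm le by (rule Mon_diff(1))
  moreover obtain s where "s \<in> Mon N (d (r j) - j)" "e (r j) = e (r 0) + s"
    using Mon_diff(2)[OF mm le] by blast
  ultimately show False using bad[of j "r j"] by blast
qed

text \<open>
  Otherwise a sequence of ideals with ever later powers of the last variable has a subsequence
  converging degree by degree. The limit is finitely generated, so it is contained in, and by
  its Hilbert function equal to, a member of the sequence; but it contains no such power.
\<close>

lemma hilbert_function_bound:
  fixes \<L> :: "(nat \<Rightarrow> (nat \<Rightarrow>\<^sub>0 nat) set) set"
  assumes sub: "\<And>L d. L \<in> \<L> \<Longrightarrow> L d \<subseteq> Mon N d"
    and up: "\<And>L d j e s. L \<in> \<L> \<Longrightarrow> e \<in> L d \<Longrightarrow> s \<in> Mon N j \<Longrightarrow> e + s \<in> L (d + j)"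
    and card: "\<And>L L' d. L \<in> \<L> \<Longrightarrow> L' \<in> \<L> \<Longrightarrow> card (L d) = card (L' d)"
  shows "\<exists>D. \<forall>L\<in>\<L>. \<forall>k. Poly_Mapping.single N k \<in> L k \<longrightarrow> (\<exists>j\<le>D. Poly_Mapping.single N j \<in> L j)"
proof (rule ccontr)
  assume "\<not> ?thesis"
  then have "\<forall>D. \<exists>L k. L \<in> \<L> \<and> Poly_Mapping.single N k \<in> L k \<and> (\<forall>j\<le>D. Poly_Mapping.single N j \<notin> L j)"
    by blast
  then obtain L k where L: "\<And>D. L D \<in> \<L>" "\<And>D. Poly_Mapping.single N (k D) \<in> L D (k D)"
      "\<And>D j. j \<le> D \<Longrightarrow> Poly_Mapping.single N j \<notin> L D j"
    by metis
  \<comment> \<open>The part of degree n is constant along the subsequence. This can be arranged by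
    the pigeonhole principle, as \<open>Mon N n\<close> has only finitely many subsets.\<close>
  define P where "P = (\<lambda>n (s :: nat \<Rightarrow> nat). \<exists>A. \<forall>i. L (s i) n = A)"
  interpret subseqs P
  proof
    fix n and s :: "nat \<Rightarrow> nat"
    assume "strict_mono s"
    have "range (\<lambda>i. L (s i) n) \<subseteq> Pow (Mon N n)" using sub L(1) by blast
    then have "finite (range (\<lambda>i. L (s i) n))" using finite_Mon by (meson finite_Pow_iff finite_subset)
    then obtain a where a: "infinite {i. L (s i) n = L (s a) n}"
      using pigeonhole_infinite[of UNIV "\<lambda>i. L (s i) n"] by auto
    define r where "r = enumerate {i. L (s i) n = L (s a) n}"
    have "strict_mono r" unfolding r_def using a by (rule strict_mono_enumerate)
    moreover have "L (s (r i)) n = L (s a) n" for i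
      using enumerate_in_set[OF a, of i] by (simp add: r_def)
    ultimately show "\<exists>r'. strict_mono r' \<and> P n (s \<circ> r')" by (auto simp: P_def)
  qed
  \<comment> \<open>In degree n the diagonal sequence is constant from index \<open>Suc n\<close>
    on; its value there is the limit \<open>\<Lambda> n\<close>.\<close>
  have "P n (diagseq \<circ> ((+) (Suc n)))" for n
    by (rule diagseq_holds) (auto simp: P_def)
  then have "\<forall>n. \<exists>A. \<forall>i. L (diagseq (Suc n + i)) n = A" by (simp add: P_def)
  then obtain \<Lambda> where \<Lambda>': "\<And>n i. L (diagseq (Suc n + i)) n = \<Lambda> n" by metis
  have \<Lambda>: "L (diagseq i) n = \<Lambda> n" if "n < i" for n i
    using \<Lambda>'[of n "i - Suc n"] that by simp
  have "\<Lambda> d \<subseteq> Mon N d" for d using sub[OF L(1)] \<Lambda>[of d "Suc d"] by auto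
  then obtain d0 where d0: "\<And>d e. e \<in> \<Lambda> d \<Longrightarrow>
      \<exists>d'\<le>d0. d' \<le> d \<and> (\<exists>e'\<in>\<Lambda> d'. \<exists>s\<in>Mon N (d - d'). e = e' + s)"
    using dickson[of \<Lambda> N] by blast
  \<comment> \<open>This member agrees with \<open>\<Lambda>\<close> in all degrees up to
    \<open>d0\<close>, hence contains the generators of \<open>\<Lambda>\<close> and everything they
    generate.\<close>
  define i where "i = diagseq (Suc d0)"
  have "\<Lambda> d = L i d" for d
  proof (rule card_subset_eq)
    show "finite (L i d)" using sub[OF L(1)] finite_Mon finite_subset by blast
    show "\<Lambda> d \<subseteq> L i d"
    proof
      fix e assume "e \<in> \<Lambda> d"
      then obtain d' e' s where *: "d' \<le> d0" "d' \<le> d" "e' \<in> \<Lambda> d'" "s \<in> Mon N (d - d')" "e = e' + s"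
        using d0 by blast
      then have "e' \<in> L i d'" using \<Lambda>[of d' "Suc d0"] by (simp add: i_def)
      then show "e \<in> L i d" using up[OF L(1) _ *(4)] * by fastforce
    qed
    \<comment> \<open>\<open>\<Lambda> d\<close> is the part of degree d of some member of the
      family, and all members have the same Hilbert function.\<close>
    show "card (\<Lambda> d) = card (L i d)" using \<Lambda>[of d "Suc d"] card[OF L(1) L(1)] by (metis lessI)
  qed
  then have "Poly_Mapping.single N (k i) \<in> \<Lambda> (k i)" using L(2) by simp
  moreover have "Poly_Mapping.single N j \<notin> \<Lambda> j" for j
  proof -
    \<comment> \<open>In degree j the limit agrees with the member of index
      \<open>diagseq (Suc j)\<close>, which omits the powers up to that index and hence the one of
      degree j.\<close>
    have "j \<le> diagseq (Suc j)" using strict_mono_imp_increasing[OF subseq_diagseq, of "Suc j"] by simp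
    then show ?thesis using L(3) \<Lambda>[of j "Suc j"] by (metis lessI)
  qed
  ultimately show False by blast
qed

section \<open>Pulling back along a monomial map\<close>

definition push :: "nat \<Rightarrow> nat \<Rightarrow> ((nat \<Rightarrow>\<^sub>0 nat) \<Rightarrow> 'g) \<Rightarrow> ((nat \<Rightarrow>\<^sub>0 nat) \<Rightarrow> 'k::field) \<Rightarrow> 'g \<Rightarrow> 'k" where
  "push N d \<phi> F u = (\<Sum>m\<in>{m \<in> Mon N d. \<phi> m = u}. F m)"

text \<open>The part of degree d of the pullback of \<open>W\<close> under the substitution sending
  the monomial m to the Laurent monomial with exponent \<open>\<phi> m\<close>. The image of a form
  is \<open>push\<close>, which adds up the coefficients of monomials with equal image.\<close>

definition homog :: "nat \<Rightarrow> ((nat \<Rightarrow>\<^sub>0 nat) \<Rightarrow> 'g) \<Rightarrow> ('g \<Rightarrow> 'k::field) set \<Rightarrow> nat \<Rightarrow> ((nat \<Rightarrow>\<^sub>0 nat) \<Rightarrow> 'k) set" where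
  "homog N \<phi> W d = {F. (\<forall>m. F m \<noteq> 0 \<longrightarrow> m \<in> Mon N d) \<and> push N d \<phi> F \<in> W}"

lemma linear_closed_homog:
  assumes "linear_closed W"
  shows "linear_closed (homog N \<phi> W d)"
  unfolding linear_closed_def
proof (intro conjI ballI allI)
  show "(\<lambda>_. 0) \<in> homog N \<phi> W d"
    using assms by (simp add: homog_def push_def[abs_def] linear_closed_def)
  fix F G c assume F: "F \<in> homog N \<phi> W d" and G: "G \<in> homog N \<phi> W d"
  have "push N d \<phi> (\<lambda>m. F m + c * G m) = (\<lambda>u. push N d \<phi> F u + c * push N d \<phi> G u)"
    by (simp add: push_def sum.distrib sum_distrib_left fun_eq_iff)
  also have "\<dots> \<in> W" using F G assms by (simp add: homog_def linear_closed_def)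
  finally have "push N d \<phi> (\<lambda>m. F m + c * G m) \<in> W" .
  moreover have "m \<in> Mon N d" if "F m + c * G m \<noteq> 0" for m
    using that F G unfolding homog_def by (cases "F m = 0") auto
  ultimately show "(\<lambda>m. F m + c * G m) \<in> homog N \<phi> W d" by (simp add: homog_def)
qed

text \<open>\<open>G\<close> is F multiplied by the monomial s; downstairs this is the shift by
  \<open>\<phi> s\<close>, under which \<open>W\<close> is closed. The last two clauses describe
  \<open>G\<close> in the form in which leading monomials are compared.\<close>

lemma homog_shift:
  fixes W :: "('g::ab_group_add \<Rightarrow> 'k::field) set"
  assumes W: "\<And>f a. f \<in> W \<Longrightarrow> (\<lambda>u. f (u - a)) \<in> W"
    and \<phi>: "\<And>m s. \<phi> (m + s) = \<phi> m + \<phi> s"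
    and F: "F \<in> homog N \<phi> W d" and s: "s \<in> Mon N j"
  shows "\<exists>G\<in>homog N \<phi> W (d + j). (\<forall>m. G (m + s) = F m) \<and> (\<forall>m. G m \<noteq> 0 \<longrightarrow> (\<exists>m'. m = m' + s))"
proof -
  define G where "G m = (if m \<in> range (\<lambda>m. m + s) then F (m - s) else 0)" for m
  have Gs: "G (m + s) = F m" for m by (auto simp: G_def)
  have G0: "\<exists>m'. m = m' + s" if "G m \<noteq> 0" for m using that by (auto simp: G_def split: if_splits)
  have "push N (d + j) \<phi> G = (\<lambda>u. push N d \<phi> F (u - \<phi> s))"
  proof
    fix u
    have "push N d \<phi> F (u - \<phi> s) = (\<Sum>m\<in>(\<lambda>m. m + s) ` {m \<in> Mon N d. \<phi> m = u - \<phi> s}. G m)"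
      unfolding push_def by (subst sum.reindex) (auto simp: Gs inj_on_def)
    also have "\<dots> = push N (d + j) \<phi> G u"
      unfolding push_def
    proof (rule sum.mono_neutral_left)
      show "finite {m \<in> Mon N (d + j). \<phi> m = u}" using finite_Mon by simp
      show "(\<lambda>m. m + s) ` {m \<in> Mon N d. \<phi> m = u - \<phi> s} \<subseteq> {m \<in> Mon N (d + j). \<phi> m = u}"
        using Mon_add s by (auto simp: \<phi>)
      show "\<forall>m\<in>{m \<in> Mon N (d + j). \<phi> m = u} - (\<lambda>m. m + s) ` {m \<in> Mon N d. \<phi> m = u - \<phi> s}. G m = 0"
      proof (intro ballI, rule ccontr)
        fix m assume m: "m \<in> {m \<in> Mon N (d + j). \<phi> m = u} - (\<lambda>m. m + s) ` {m \<in> Mon N d. \<phi> m = u - \<phi> s}"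
          and nz: "G m \<noteq> 0"
        obtain m' where m': "m = m' + s" using G0[OF nz] by blast
        have "F m' \<noteq> 0" using nz Gs m' by simp
        then have "m' \<in> Mon N d" using F by (simp add: homog_def)
        moreover have "\<phi> m' = u - \<phi> s" using m m' \<phi> by (simp add: eq_diff_eq)
        ultimately show False using m m' by blast
      qed
    qed
    finally show "push N (d + j) \<phi> G u = push N d \<phi> F (u - \<phi> s)" ..
  qed
  moreover have "(\<lambda>u. push N d \<phi> F (u - \<phi> s)) \<in> W" using F W by (simp add: homog_def)
  moreover have "m \<in> Mon N (d + j)" if nz: "G m \<noteq> 0" for m
  proof -
    obtain m' where m': "m = m' + s" using G0[OF nz] by blast
    have "m' \<in> Mon N d" using F nz Gs m' by (simp add: homog_def)
    then show ?thesis using Mon_add s m' by blast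
  qed
  ultimately have "G \<in> homog N \<phi> W (d + j)" by (simp add: homog_def)
  then show ?thesis using Gs G0 by blast
qed

section \<open>Leading monomials of the pullback\<close>

context valued_field
begin

text \<open>Multiplication by s adds \<open>\<omega> s\<close> to every weight and respects the
  monomial order, so all comparisons persist.\<close>

lemma lead_shift:
  assumes F: "lead \<omega> F e" and G: "\<And>m. G (m + s) = F m" "\<And>m. G m \<noteq> 0 \<Longrightarrow> \<exists>m'. m = m' + s"
    and \<omega>: "\<And>m. \<omega> (m + s) = \<omega> m + \<omega> (s :: nat \<Rightarrow>\<^sub>0 nat)"
  shows "lead \<omega> G (e + s)"
  unfolding lead_def
proof (intro conjI allI impI)
  show "G (e + s) \<noteq> 0" using F G(1) by (simp add: lead_def)
  fix m assume m: "m \<noteq> e + s" "G m \<noteq> 0"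
  obtain m' where m': "m = m' + s" using G(2) m(2) by blast
  then have "m' \<noteq> e" "F m' \<noteq> 0" using m G(1) by auto
  then have "val (F e) + \<omega> e < val (F m') + \<omega> m' \<or> val (F e) + \<omega> e = val (F m') + \<omega> m' \<and> m' < e"
    using F by (simp add: lead_def)
  then show "val (G (e + s)) + \<omega> (e + s) < val (G m) + \<omega> m \<or>
      val (G (e + s)) + \<omega> (e + s) = val (G m) + \<omega> m \<and> m < e + s"
    by (auto simp: m' G(1) \<omega>)
qed

text \<open>All monomials mapped to 0 have weight 0, like z, so strictness at z keeps their
  coefficients from cancelling \<open>F z\<close>. Every other coefficient of the image is a sum of
  elements lying above the required bound.\<close>

lemma strict_min_push:
  assumes F: "F \<in> homog N \<phi> W d" "strict_min (\<omega> \<circ> \<phi>) F z"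
    and z: "z \<in> Mon N d" "\<phi> z = 0" and \<omega>: "\<omega> 0 = (0::real)"
  shows "strict_min \<omega> (push N d \<phi> F) 0"
proof -
  have Fz: "F z \<noteq> 0" using F by (simp add: strict_min_def)
  have ab: "above (val (F z) - \<omega> (\<phi> m)) (F m)" if "m \<noteq> z" for m
    using F(2) that by (simp add: strict_min_def z \<omega>)
  have "push N d \<phi> F 0 = F z + (\<Sum>m\<in>{m \<in> Mon N d. \<phi> m = 0} - {z}. F m)"
    unfolding push_def using finite_Mon z by (subst sum.remove[of _ z]) auto
  moreover have "above (val (F z)) (\<Sum>m\<in>{m \<in> Mon N d. \<phi> m = 0} - {z}. F m)"
    using ab \<omega> by (intro above_sum) fastforce
  ultimately have 0: "push N d \<phi> F 0 \<noteq> 0" "val (push N d \<phi> F 0) = val (F z)"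
    using val_add_above[OF Fz] by auto
  have "above (val (F z) - \<omega> u) (push N d \<phi> F u)" if "u \<noteq> 0" for u
    unfolding push_def using ab that z(2) by (intro above_sum) fastforce
  then show ?thesis using 0 by (simp add: strict_min_def \<omega>)
qed

text \<open>A single \<open>E\<close> serves all additive weights. Moving the minimum from u to 0 is
  harmless, as \<open>W\<close> is closed under shifts, and lets it be lifted to a power of the
  homogenising variable.\<close>

lemma degree_bound:
  fixes W :: "('g::ab_group_add \<Rightarrow> 'k) set" and \<phi> :: "(nat \<Rightarrow>\<^sub>0 nat) \<Rightarrow> 'g"
  assumes W: "linear_closed W" "\<And>f a. f \<in> W \<Longrightarrow> (\<lambda>u. f (u - a)) \<in> W"
      "\<And>f. f \<in> W \<Longrightarrow> finite {u. f u \<noteq> 0}"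
    and \<phi>: "\<And>m s. \<phi> (m + s) = \<phi> m + \<phi> s" "\<And>d. \<phi> (Poly_Mapping.single N d) = 0"
      "\<And>u. \<exists>d. \<exists>m\<in>Mon N d. \<phi> m = u"
  shows "\<exists>E. finite E \<and> (\<forall>\<omega> f u. (\<forall>a b. \<omega> (a + b) = \<omega> a + \<omega> b) \<longrightarrow> f \<in> W \<longrightarrow> strict_min \<omega> f u \<longrightarrow>
     (\<exists>g\<in>W. {v. g v \<noteq> 0} \<subseteq> E \<and> strict_min \<omega> g 0))"
proof -
  let ?z = "Poly_Mapping.single N :: nat \<Rightarrow> nat \<Rightarrow>\<^sub>0 nat"
  let ?J = "homog N \<phi> W"
  define \<Omega> where "\<Omega> = {\<omega> :: 'g \<Rightarrow> real. \<forall>a b. \<omega> (a + b) = \<omega> a + \<omega> b}"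
  define \<L> where "\<L> = (\<lambda>\<omega> d. leads (\<omega> \<circ> \<phi>) (?J d)) ` \<Omega>"
  have J: "m \<in> Mon N d" if "F \<in> ?J d" "F m \<noteq> 0" for F d m using that by (simp add: homog_def)
  have "\<exists>D. \<forall>L\<in>\<L>. \<forall>k. ?z k \<in> L k \<longrightarrow> (\<exists>j\<le>D. ?z j \<in> L j)"
  proof (rule hilbert_function_bound)
    fix L d assume "L \<in> \<L>"
    then obtain \<omega> where \<omega>: "\<omega> \<in> \<Omega>" "L = (\<lambda>d. leads (\<omega> \<circ> \<phi>) (?J d))" by (auto simp: \<L>_def)
    show "L d \<subseteq> Mon N d" using J by (auto simp: \<omega> leads_def lead_def)
    {
      fix j e s assume e: "e \<in> L d" and s: "s \<in> Mon N j"
      then obtain F where F: "F \<in> ?J d" "lead (\<omega> \<circ> \<phi>) F e" by (auto simp: \<omega> leads_def)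
      obtain G where G: "G \<in> ?J (d + j)" "\<And>m. G (m + s) = F m" "\<And>m. G m \<noteq> 0 \<Longrightarrow> \<exists>m'. m = m' + s"
        using homog_shift[of W, OF W(2) \<phi>(1) F(1) s] by blast
      have "(\<omega> \<circ> \<phi>) (m + s) = (\<omega> \<circ> \<phi>) m + (\<omega> \<circ> \<phi>) s" for m
        using \<omega>(1) by (simp add: \<Omega>_def \<phi>(1))
      with F(2) G(2,3) have "lead (\<omega> \<circ> \<phi>) G (e + s)" by (rule lead_shift)
      then show "e + s \<in> L (d + j)" using G(1) by (auto simp: \<omega> leads_def)
    }
    fix L' assume "L' \<in> \<L>"
    then obtain \<omega>' where \<omega>': "L' = (\<lambda>d. leads (\<omega>' \<circ> \<phi>) (?J d))" by (auto simp: \<L>_def)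
    show "card (L d) = card (L' d)"
      unfolding \<omega> \<omega>' using card_leads_le[OF linear_closed_homog[OF W(1)] finite_Mon J] by (intro antisym)
  qed
  then obtain D where D: "\<And>\<omega> k. \<omega> \<in> \<Omega> \<Longrightarrow> ?z k \<in> leads (\<omega> \<circ> \<phi>) (?J k) \<Longrightarrow>
      \<exists>j\<le>D. ?z j \<in> leads (\<omega> \<circ> \<phi>) (?J j)"
    unfolding \<L>_def by fastforce
  define E where "E = (\<Union>k\<le>D. \<phi> ` Mon N k)"
  have "finite E" unfolding E_def using finite_Mon by blast
  moreover have "\<exists>g\<in>W. {v. g v \<noteq> 0} \<subseteq> E \<and> strict_min \<omega> g 0"
    if add: "\<forall>a b. \<omega> (a + b) = \<omega> a + \<omega> b" and fW: "f \<in> W" and fu: "strict_min \<omega> f u" for \<omega> f u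
  proof -
    have \<omega>: "\<omega> \<in> \<Omega>" using add by (simp add: \<Omega>_def)
    have \<omega>0: "\<omega> 0 = 0" using add[rule_format, of 0 0] by simp
    define h where "h = (\<lambda>v. f (v + u))"
    have hW: "h \<in> W" using W(2)[OF fW, of "- u"] by (simp add: h_def)
    have h0: "h 0 \<noteq> 0" using fu by (simp add: h_def strict_min_def)
    have hmin: "above (val (h 0) - \<omega> v) (h v)" if "v \<noteq> 0" for v
    proof -
      have "above (val (f u) + \<omega> u - \<omega> (v + u)) (f (v + u))" using fu that by (simp add: strict_min_def)
      then show ?thesis using add by (simp add: h_def)
    qed
    define S where "S = {v. h v \<noteq> 0}"
    have S: "finite S" "0 \<in> S" using W(3)[OF hW] h0 by (auto simp: S_def)
    \<comment> \<open>The exponent 0 is lifted to the trivial monomial, so that padding turns it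
      into a pure power of the homogenising variable.\<close>
    have "\<forall>v. \<exists>d m. m \<in> Mon N d \<and> \<phi> m = v \<and> (v = 0 \<longrightarrow> d = 0 \<and> m = ?z 0)"
    proof
      fix v
      show "\<exists>d m. m \<in> Mon N d \<and> \<phi> m = v \<and> (v = 0 \<longrightarrow> d = 0 \<and> m = ?z 0)"
      proof (cases "v = 0")
        case True
        then show ?thesis using single_Mon[of N 0] \<phi>(2)[of 0] by blast
      qed (use \<phi>(3)[of v] in blast)
    qed
    then obtain \<delta> \<rho>0 where \<rho>0: "\<And>v. \<rho>0 v \<in> Mon N (\<delta> v)" "\<And>v. \<phi> (\<rho>0 v) = v" "\<delta> 0 = 0" "\<rho>0 0 = ?z 0"
      by metis
    define d where "d = Max (\<delta> ` S)"
    \<comment> \<open>Padding with the homogenising variable brings all lifts to the common degree d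
      without changing their images.\<close>
    define \<rho> where "\<rho> = (\<lambda>v. \<rho>0 v + ?z (d - \<delta> v))"
    have \<delta>: "\<delta> v \<le> d" if "v \<in> S" for v using S that by (simp add: d_def)
    have \<rho>M: "\<rho> v \<in> Mon N d" if "v \<in> S" for v
      using Mon_add[OF \<rho>0(1) single_Mon, of v "d - \<delta> v"] \<delta>[OF that] by (simp add: \<rho>_def)
    have \<phi>\<rho>: "\<phi> (\<rho> v) = v" for v by (simp add: \<rho>_def \<phi> \<rho>0)
    have \<rho>z: "\<rho> 0 = ?z d" by (simp add: \<rho>_def \<rho>0)
    \<comment> \<open>F places each coefficient of h on one chosen lift of its exponent, so its
      image is h.\<close>
    define F where "F = (\<lambda>m. if m = \<rho> (\<phi> m) then h (\<phi> m) else 0)"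
    have FM: "m \<in> Mon N d" if "F m \<noteq> 0" for m
      using that \<rho>M[of "\<phi> m"] by (auto simp: F_def S_def split: if_splits)
    have "push N d \<phi> F v = h v" for v
    proof -
      have "push N d \<phi> F v = (\<Sum>m\<in>(if v \<in> S then {\<rho> v} else {}). F m)"
        unfolding push_def
      proof (rule sum.mono_neutral_right)
        show "finite {m \<in> Mon N d. \<phi> m = v}" using finite_Mon by simp
        show "(if v \<in> S then {\<rho> v} else {}) \<subseteq> {m \<in> Mon N d. \<phi> m = v}" using \<rho>M \<phi>\<rho> by auto
        show "\<forall>m\<in>{m \<in> Mon N d. \<phi> m = v} - (if v \<in> S then {\<rho> v} else {}). F m = 0"
          by (auto simp: F_def S_def)
      qed
      then show ?thesis by (auto simp: F_def S_def \<phi>\<rho>)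
    qed
    then have "push N d \<phi> F \<in> W" using hW by presburger
    then have FJ: "F \<in> ?J d" using FM by (simp add: homog_def)
    have "lead (\<omega> \<circ> \<phi>) F (?z d)" unfolding lead_def
    proof (intro conjI allI impI)
      have Fz: "F (?z d) = h 0" using \<phi>(2) \<rho>z by (simp add: F_def)
      then show "F (?z d) \<noteq> 0" using h0 by simp
      fix m assume m: "m \<noteq> ?z d" "F m \<noteq> 0"
      then have *: "m = \<rho> (\<phi> m)" "F m = h (\<phi> m)" by (auto simp: F_def split: if_splits)
      then have "\<phi> m \<noteq> 0" using m(1) \<rho>z by metis
      then have "val (h 0) - \<omega> (\<phi> m) < val (F m)" using hmin[of "\<phi> m"] m(2) * by (simp add: above_def)
      then show "val (F (?z d)) + (\<omega> \<circ> \<phi>) (?z d) < val (F m) + (\<omega> \<circ> \<phi>) m \<or>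
          val (F (?z d)) + (\<omega> \<circ> \<phi>) (?z d) = val (F m) + (\<omega> \<circ> \<phi>) m \<and> m < ?z d"
        by (simp add: Fz \<phi>(2) \<omega>0)
    qed
    then have "?z d \<in> leads (\<omega> \<circ> \<phi>) (?J d)" using FJ by (auto simp: leads_def)
    then obtain j where j: "j \<le> D" "?z j \<in> leads (\<omega> \<circ> \<phi>) (?J j)" using D \<omega> by blast
    then obtain G where G: "G \<in> ?J j" "lead (\<omega> \<circ> \<phi>) G (?z j)" by (auto simp: leads_def)
    \<comment> \<open>Ties would have to be won against a smaller monomial, and none of degree j is
      smaller than \<open>?z j\<close>.\<close>
    have "strict_min (\<omega> \<circ> \<phi>) G (?z j)"
      unfolding strict_min_def above_def
    proof (intro conjI allI impI)
      show "G (?z j) \<noteq> 0" using G(2) by (simp add: lead_def)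
      fix m assume m: "m \<noteq> ?z j"
      show "G m = 0 \<or> val (G (?z j)) + (\<omega> \<circ> \<phi>) (?z j) - (\<omega> \<circ> \<phi>) m < val (G m)"
      proof (cases "G m = 0")
        case False
        then have "?z j < m" using single_less_Mon J[OF G(1)] m by blast
        then show ?thesis using G(2) m False by (auto simp: lead_def)
      qed simp
    qed
    then have "strict_min \<omega> (push N j \<phi> G) 0"
      using strict_min_push[OF G(1) _ single_Mon \<phi>(2), of \<omega>] \<omega>0 by blast
    moreover have "push N j \<phi> G \<in> W" using G(1) by (simp add: homog_def)
    moreover have "v \<in> E" if "push N j \<phi> G v \<noteq> 0" for v
    proof -
      have "{m \<in> Mon N j. \<phi> m = v} \<noteq> {}" using that unfolding push_def by (metis sum.empty)
      then show ?thesis using j(1) by (auto simp: E_def)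
    qed
    ultimately show ?thesis by blast
  qed
  ultimately show ?thesis by blast
qed

end

section \<open>Hyperplane arrangements\<close>

text \<open>For finite \<open>H\<close>, the closed face of the arrangement that has x in its
  relative interior. When x lies on a hyperplane, both inequalities are kept, hence the
  equation.\<close>

definition cell :: "((real ^ 'n::finite) \<times> real) set \<Rightarrow> real ^ 'n \<Rightarrow> (real ^ 'n) set" where
  "cell H x = {y. \<forall>(a, b)\<in>H. (a \<bullet> x \<le> b \<longrightarrow> a \<bullet> y \<le> b) \<and> (b \<le> a \<bullet> x \<longrightarrow> b \<le> a \<bullet> y)}"

lemma cell_self: "x \<in> cell H x"
  by (auto simp: cell_def)

lemma cell_mono: "y \<in> cell H x \<Longrightarrow> cell H y \<subseteq> cell H x"
  unfolding cell_def by fastforce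

lemma polyhedron_cell:
  assumes "finite H"
  shows "polyhedron (cell H x)"
proof -
  have "cell H x = (\<Inter>(a, b)\<in>H. {y. a \<bullet> x \<le> b \<longrightarrow> a \<bullet> y \<le> b} \<inter> {y. b \<le> a \<bullet> x \<longrightarrow> b \<le> a \<bullet> y})"
    by (auto simp: cell_def)
  also have "polyhedron \<dots>"
  proof (intro polyhedron_Inter ballI)
    show "finite ((\<lambda>(a, b). {y. a \<bullet> x \<le> b \<longrightarrow> a \<bullet> y \<le> b} \<inter> {y. b \<le> a \<bullet> x \<longrightarrow> b \<le> a \<bullet> y}) ` H)"
      using assms by blast
    fix P assume "P \<in> (\<lambda>(a, b). {y. a \<bullet> x \<le> b \<longrightarrow> a \<bullet> y \<le> b} \<inter> {y. b \<le> a \<bullet> x \<longrightarrow> b \<le> a \<bullet> y}) ` H"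
    then obtain a b where P: "P = {y. a \<bullet> x \<le> b \<longrightarrow> a \<bullet> y \<le> b} \<inter> {y. b \<le> a \<bullet> x \<longrightarrow> b \<le> a \<bullet> y}" by auto
    have "polyhedron {y. a \<bullet> x \<le> b \<longrightarrow> a \<bullet> y \<le> b}"
      by (cases "a \<bullet> x \<le> b") (auto simp: polyhedron_halfspace_le)
    moreover have "polyhedron {y. b \<le> a \<bullet> x \<longrightarrow> b \<le> a \<bullet> y}"
      by (cases "b \<le> a \<bullet> x") (auto simp: polyhedron_halfspace_ge)
    ultimately show "polyhedron P" unfolding P by (rule polyhedron_Int)
  qed
  finally show ?thesis .
qed

lemma convex_cell: "finite H \<Longrightarrow> convex (cell H x)"
  by (intro polyhedron_imp_convex polyhedron_cell)

lemma open_segment_convex_combination: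
  fixes p :: "'a::real_inner"
  assumes "p \<in> open_segment y z"
  obtains u where "0 < u" "u < 1" "\<And>a. a \<bullet> p = (1 - u) * (a \<bullet> y) + u * (a \<bullet> z)"
  using assms by (auto simp: in_segment inner_add_right)

text \<open>On \<open>cell H x\<close> each affine form a . y - b keeps a weak sign. If r violates a
  condition of \<open>cell H y\<close>, the form has the wrong strict sign at r and weakly the same
  sign at s, hence the wrong sign at every point strictly between them.\<close>

lemma cell_Int_face_of:
  assumes "finite H"
  shows "cell H x \<inter> cell H y face_of cell H x"
  unfolding face_of_def
proof (intro conjI ballI impI)
  show "convex (cell H x \<inter> cell H y)" using assms by (intro convex_Int convex_cell)
  have *: "r \<in> cell H y" if r: "r \<in> cell H x" "s \<in> cell H x" and p: "p \<in> cell H y" "p \<in> open_segment r s" for r s p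
    unfolding cell_def mem_Collect_eq
  proof safe
    fix a b assume ab: "(a, b) \<in> H"
    obtain u where u: "0 < u" "u < 1" "a \<bullet> p = (1 - u) * (a \<bullet> r) + u * (a \<bullet> s)"
      using open_segment_convex_combination[OF p(2)] by metis
    have rx: "a \<bullet> x \<le> b \<Longrightarrow> a \<bullet> r \<le> b" "b \<le> a \<bullet> x \<Longrightarrow> b \<le> a \<bullet> r"
      "a \<bullet> x \<le> b \<Longrightarrow> a \<bullet> s \<le> b" "b \<le> a \<bullet> x \<Longrightarrow> b \<le> a \<bullet> s"
      using r ab by (auto simp: cell_def)
    have dec: "a \<bullet> p - b = (1 - u) * (a \<bullet> r - b) + u * (a \<bullet> s - b)"
      unfolding u(3) by (simp add: algebra_simps)
    show "a \<bullet> r \<le> b" if "a \<bullet> y \<le> b"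
    proof (rule ccontr)
      assume "\<not> ?thesis"
      then have "b < a \<bullet> r" "b \<le> a \<bullet> s" using rx by (auto intro: linear[THEN disjE, of "a \<bullet> x" b])
      then have "0 < (1 - u) * (a \<bullet> r - b)" "0 \<le> u * (a \<bullet> s - b)" using u by auto
      then have "b < a \<bullet> p" using dec by linarith
      then show False using that p(1) ab by (auto simp: cell_def)
    qed
    show "b \<le> a \<bullet> r" if "b \<le> a \<bullet> y"
    proof (rule ccontr)
      assume "\<not> ?thesis"
      then have "a \<bullet> r < b" "a \<bullet> s \<le> b" using rx by (auto intro: linear[THEN disjE, of "a \<bullet> x" b])
      then have "(1 - u) * (a \<bullet> r - b) < 0" "u * (a \<bullet> s - b) \<le> 0" using u
        by (auto simp: mult_less_0_iff mult_le_0_iff)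
      then have "a \<bullet> p < b" using dec by linarith
      then show False using that p(1) ab by (auto simp: cell_def)
    qed
  qed
  fix r s p assume "r \<in> cell H x" "s \<in> cell H x" "p \<in> cell H x \<inter> cell H y" "p \<in> open_segment r s"
  then show "r \<in> cell H x \<inter> cell H y" "s \<in> cell H x \<inter> cell H y"
    using *[of r s p] *[of s r p] by (auto simp: open_segment_commute)
qed auto

text \<open>Inequalities strict at x survive a small step away from y. A hyperplane through x also
  contains y, and so the whole line.\<close>

lemma cell_extend_beyond:
  assumes "finite H" "y \<in> cell H x" "y \<noteq> x"
  obtains z where "z \<in> cell H x" "x \<in> open_segment y z"
proof -
  define z where "z = (\<lambda>t. x + t *\<^sub>R (x - y))"
  have "\<forall>\<^sub>F t in at_right 0. case h of (a, b) \<Rightarrow>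
      (a \<bullet> x \<le> b \<longrightarrow> a \<bullet> z t \<le> b) \<and> (b \<le> a \<bullet> x \<longrightarrow> b \<le> a \<bullet> z t)" if h: "h \<in> H" for h
  proof -
    obtain a b where ab: "h = (a, b)" by fastforce
    have lim: "((\<lambda>t. a \<bullet> z t) \<longlongrightarrow> a \<bullet> z 0) (at_right 0)" unfolding z_def by (intro tendsto_intros)
    consider "a \<bullet> x < b" | "a \<bullet> x > b" | "a \<bullet> x = b" by linarith
    then show ?thesis
    proof cases
      case 1
      then have "\<forall>\<^sub>F t in at_right 0. a \<bullet> z t < b"
        using order_tendstoD(2)[OF lim, of b] by (simp add: z_def)
      then show ?thesis by eventually_elim (use 1 in \<open>auto simp: ab\<close>)
    next
      case 2
      then have "\<forall>\<^sub>F t in at_right 0. a \<bullet> z t > b"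
        using order_tendstoD(1)[OF lim, of b] by (simp add: z_def)
      then show ?thesis by eventually_elim (use 2 in \<open>auto simp: ab\<close>)
    next
      case 3
      then have "a \<bullet> y = b" using assms(2) h ab by (fastforce simp: cell_def)
      then show ?thesis using 3 by (simp add: ab z_def inner_add_right inner_diff_right)
    qed
  qed
  then have "\<forall>\<^sub>F t in at_right 0. \<forall>h\<in>H. case h of (a, b) \<Rightarrow>
      (a \<bullet> x \<le> b \<longrightarrow> a \<bullet> z t \<le> b) \<and> (b \<le> a \<bullet> x \<longrightarrow> b \<le> a \<bullet> z t)"
    using assms(1) by (simp add: eventually_ball_finite_distrib)
  then have "\<forall>\<^sub>F t in at_right 0. z t \<in> cell H x" by (simp add: cell_def)
  moreover have "\<forall>\<^sub>F t in at_right 0. 0 < (t::real)" by (rule eventually_at_right_less)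
  ultimately have "\<forall>\<^sub>F t in at_right 0. z t \<in> cell H x \<and> 0 < t" by eventually_elim auto
  then obtain t where t: "z t \<in> cell H x" "0 < t" using eventually_happens by force
  have "x \<in> open_segment y (z t)" unfolding in_segment
  \<comment> \<open>The coefficient comes from solving \<open>z t = x + t *\<^sub>R (x - y)\<close>
    for x.\<close>
  proof (intro conjI exI[of _ "1 / (1 + t)"])
    show "y \<noteq> z t"
    proof
      assume "y = z t"
      then have "(1 + t) *\<^sub>R (x - y) = 0" by (simp add: z_def algebra_simps)
      then show False using t(2) assms(3) by simp
    qed
    have *: "(1 / (1 + t)) * t = 1 - 1 / (1 + t)" using t(2) by (simp add: field_simps)
    have "(1 / (1 + t)) *\<^sub>R z t = (1 / (1 + t)) *\<^sub>R x + (1 - 1 / (1 + t)) *\<^sub>R (x - y)"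
      unfolding *[symmetric] z_def by (simp add: scaleR_add_right)
    then show "x = (1 - 1 / (1 + t)) *\<^sub>R y + (1 / (1 + t)) *\<^sub>R z t"
      by (simp add: algebra_simps)
  qed (use t in auto)
  then show thesis using that t by blast
qed

text \<open>Take \<open>x'\<close> in the relative interior of F. Its cell is a face of
  \<open>cell H x\<close> meeting that interior, so it contains F. Conversely, a segment from a
  point of \<open>cell H x'\<close> can be prolonged beyond \<open>x'\<close>, so the face property
  puts that point into F.\<close>

lemma face_of_cell:
  assumes "finite H" "F face_of cell H x" "F \<noteq> {}"
  obtains x' where "x' \<in> cell H x" "F = cell H x'"
proof -
  have "convex F" using assms(2) by (rule face_of_imp_convex)
  then obtain x' where x': "x' \<in> rel_interior F" using assms(3) rel_interior_eq_empty by blast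
  then have x'F: "x' \<in> F" using rel_interior_subset by blast
  have FS: "F \<subseteq> cell H x" using assms(2) by (rule face_of_imp_subset)
  have sub: "cell H x' \<subseteq> cell H x" using cell_mono x'F FS by blast
  have "cell H x \<inter> cell H x' face_of cell H x" using assms(1) by (rule cell_Int_face_of)
  then have face: "cell H x' face_of cell H x" using sub by (simp add: inf.absorb2)
  have ne: "cell H x' \<inter> rel_interior F \<noteq> {}"
    using x' cell_self[of x' H] by blast
  have "F \<subseteq> cell H x'" using subset_of_face_of[OF face FS ne] .
  moreover have "y \<in> F" if y: "y \<in> cell H x'" for y
  proof (cases "y = x'")
    case False
    then obtain z where "z \<in> cell H x'" "x' \<in> open_segment y z"
      using cell_extend_beyond[OF assms(1) y] by blast
    then show ?thesis using assms(2) y sub x'F unfolding face_of_def by blast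
  qed (simp add: x'F)
  ultimately have "F = cell H x'" by blast
  then show thesis using that x'F FS by blast
qed

section \<open>Rational complexes from arrangements\<close>

lemma finite_cells:
  fixes H :: "((real ^ 'n::finite) \<times> real) set"
  assumes "finite H"
  shows "finite (cell H ` T)"
proof -
  \<comment> \<open>A cell is determined by the two subsets of \<open>H\<close> whose respective
    weak inequalities hold at its base point.\<close>
  define g where "g = (\<lambda>(A :: ((real ^ 'n) \<times> real) set, B :: ((real ^ 'n) \<times> real) set).
     {y. (\<forall>(a, b)\<in>A. a \<bullet> y \<le> b) \<and> (\<forall>(a, b)\<in>B. b \<le> a \<bullet> y)})"
  have "cell H x = g ({(a, b) \<in> H. a \<bullet> x \<le> b}, {(a, b) \<in> H. b \<le> a \<bullet> x})" for x
    by (auto simp: cell_def g_def)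
  then have "cell H ` T \<subseteq> g ` (Pow H \<times> Pow H)" by blast
  then show ?thesis using assms by (meson finite_Pow_iff finite_SigmaI finite_imageI finite_subset)
qed

lemma rational_polyhedronI:
  fixes A :: "((real ^ 'n::finite) \<times> real) set"
  assumes "finite A" "\<And>a b. (a, b) \<in> A \<Longrightarrow> (\<forall>j. a $ j \<in> \<rat>) \<and> b \<in> \<Gamma>"
  shows "rational_polyhedron \<Gamma> {y. \<forall>(a, b)\<in>A. a \<bullet> y \<le> b}"
proof -
  obtain s :: nat and e where e: "A = e ` {i. i < s}"
    using finite_imp_nat_seg_image_inj_on[OF assms(1)] by blast
  have "(\<forall>j. fst (e i) $ j \<in> \<rat>) \<and> snd (e i) \<in> \<Gamma>" if "i < s" for i
    using that assms(2)[of "fst (e i)" "snd (e i)"] e by auto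
  moreover have "{y. \<forall>(a, b)\<in>A. a \<bullet> y \<le> b} = {y. \<forall>i<s. fst (e i) \<bullet> y \<le> snd (e i)}"
    unfolding e by (auto simp: case_prod_beta)
  ultimately show ?thesis unfolding rational_polyhedron_def
    by (intro exI[of _ s] exI[of _ "\<lambda>i. fst (e i)"] exI[of _ "\<lambda>i. snd (e i)"]) auto
qed

lemma rational_polyhedron_cell:
  assumes "finite H" "\<And>a b. (a, b) \<in> H \<Longrightarrow> (\<forall>j. a $ j \<in> \<rat>) \<and> b \<in> \<Gamma>"
    and "\<And>b. b \<in> \<Gamma> \<Longrightarrow> - b \<in> \<Gamma>"
  shows "rational_polyhedron \<Gamma> (cell H x)"
proof -
  define A where "A = {(a, b) \<in> H. a \<bullet> x \<le> b} \<union> (\<lambda>(a, b). (- a, - b)) ` {(a, b) \<in> H. b \<le> a \<bullet> x}"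
  have "finite {(a, b) \<in> H. a \<bullet> x \<le> b}" "finite {(a, b) \<in> H. b \<le> a \<bullet> x}"
    using assms(1) by (auto intro: finite_subset[of _ H])
  then have "finite A" by (simp add: A_def)
  moreover have "(\<forall>j. a $ j \<in> \<rat>) \<and> b \<in> \<Gamma>" if "(a, b) \<in> A" for a b
    using that assms(2,3) unfolding A_def by fastforce
  ultimately have "rational_polyhedron \<Gamma> {y. \<forall>(a, b)\<in>A. a \<bullet> y \<le> b}" by (rule rational_polyhedronI)
  also have "{y. \<forall>(a, b)\<in>A. a \<bullet> y \<le> b} = cell H x"
    unfolding A_def cell_def by (auto simp: ball_Un)
  finally show ?thesis .
qed

text \<open>A face of a cell is the cell of one of its own points. That point lies in T, so the
  cells of points of T are closed under faces.\<close>

lemma arrangement_subcomplex: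
  assumes "finite H" "\<And>a b. (a, b) \<in> H \<Longrightarrow> (\<forall>j. a $ j \<in> \<rat>) \<and> b \<in> \<Gamma>"
    and "\<And>b. b \<in> \<Gamma> \<Longrightarrow> - b \<in> \<Gamma>"
    and T: "\<And>x. x \<in> T \<Longrightarrow> cell H x \<subseteq> T"
  shows "finite (cell H ` T) \<and> rational_complex \<Gamma> (cell H ` T) \<and> \<Union>(cell H ` T) = T"
  unfolding rational_complex_def polyhedral_complex_def
proof (intro conjI ballI allI impI)
  show "finite (cell H ` T)" using assms(1) by (rule finite_cells)
  show "\<Union>(cell H ` T) = T" using T cell_self by blast
  fix P assume "P \<in> cell H ` T"
  then obtain x where x: "x \<in> T" "P = cell H x" by blast
  show "polyhedron P" using polyhedron_cell[OF assms(1)] x by blast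
  show "rational_polyhedron \<Gamma> P" unfolding x using assms(1-3) by (rule rational_polyhedron_cell)
  {
    fix F assume F: "F face_of P \<and> F \<noteq> {}"
    then obtain x' where "x' \<in> cell H x" "F = cell H x'" using face_of_cell[OF assms(1)] x by blast
    then show "F \<in> cell H ` T" using T x by blast
  }
  fix Q assume "Q \<in> cell H ` T"
  then obtain y where y: "Q = cell H y" by blast
  show "P \<inter> Q = {} \<or> P \<inter> Q face_of P \<and> P \<inter> Q face_of Q"
    using cell_Int_face_of[OF assms(1), of x y] cell_Int_face_of[OF assms(1), of y x] x y by (simp add: inf_commute)
qed

section \<open>Finite tropical bases\<close>

lemma laurent_eval_superset:
  assumes "finite S" "Poly_Mapping.keys f \<subseteq> S"
  shows "laurent_eval f x = (\<Sum>u\<in>S. Poly_Mapping.lookup f u * (\<Prod>i\<in>UNIV. (x $ i) powi (u $ i)))"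
  unfolding laurent_eval_def using assms by (intro sum.mono_neutral_left) (auto simp: in_keys_iff)

lemma monomial_add:
  fixes x :: "'k::field ^ 'n::finite"
  assumes "x \<in> torus"
  shows "(\<Prod>i\<in>UNIV. (x $ i) powi ((u + v) $ i)) =
    (\<Prod>i\<in>UNIV. (x $ i) powi (u $ i)) * (\<Prod>i\<in>UNIV. (x $ i) powi (v $ i))"
  using assms by (simp add: torus_def power_int_add prod.distrib)

lemma linear_closed_vanishing_ideal:
  fixes X :: "('k::field ^ 'n::finite) set"
  shows "linear_closed (Poly_Mapping.lookup ` vanishing_ideal X)"
  unfolding linear_closed_def
proof (intro conjI ballI allI)
  show "(\<lambda>_. 0) \<in> Poly_Mapping.lookup ` vanishing_ideal X"
    by (rule image_eqI[of _ _ 0]) (auto simp: vanishing_ideal_def laurent_eval_def)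
  fix f' g' c
  assume "f' \<in> Poly_Mapping.lookup ` vanishing_ideal X" "g' \<in> Poly_Mapping.lookup ` vanishing_ideal X"
  then obtain f g where f: "f \<in> vanishing_ideal X" "f' = Poly_Mapping.lookup f"
    and g: "g \<in> vanishing_ideal X" "g' = Poly_Mapping.lookup g" by blast
  define S where "S = Poly_Mapping.keys f \<union> Poly_Mapping.keys g"
  have "{u. f' u + c * g' u \<noteq> 0} \<subseteq> S" by (auto simp: S_def f g in_keys_iff)
  moreover have S: "finite S" by (simp add: S_def)
  ultimately have fin: "finite {u. f' u + c * g' u \<noteq> 0}" by (rule finite_subset)
  define h where "h = Abs_poly_mapping (\<lambda>u. f' u + c * g' u)"
  have h: "Poly_Mapping.lookup h = (\<lambda>u. f' u + c * g' u)"
    unfolding h_def using fin by (rule lookup_Abs_poly_mapping)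
  have sub: "Poly_Mapping.keys h \<subseteq> S" by (auto simp: S_def in_keys_iff h f g)
  have "laurent_eval h x = laurent_eval f x + c * laurent_eval g x" for x
    using S sub by (simp add: laurent_eval_superset[of S] S_def[symmetric] h f g)
      (simp add: laurent_eval_superset[of S] S_def sum.distrib sum_distrib_left algebra_simps)
  then have "h \<in> vanishing_ideal X" using f g by (simp add: vanishing_ideal_def)
  then show "(\<lambda>u. f' u + c * g' u) \<in> Poly_Mapping.lookup ` vanishing_ideal X" using h by (metis imageI)
qed

text \<open>The shift is multiplication by the monomial with exponent a; evaluation is
  multiplicative because torus points have nonzero coordinates.\<close>

lemma shift_vanishing_ideal:
  fixes X :: "('k::field ^ 'n::finite) set"
  assumes X: "X \<subseteq> torus" and f: "f' \<in> Poly_Mapping.lookup ` vanishing_ideal X"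
  shows "(\<lambda>u. f' (u - a)) \<in> Poly_Mapping.lookup ` vanishing_ideal X"
proof -
  obtain f where f: "f \<in> vanishing_ideal X" "f' = Poly_Mapping.lookup f" using f by blast
  define S where "S = (\<lambda>u. u + a) ` Poly_Mapping.keys f"
  have S: "finite S" by (simp add: S_def)
  have memS: "u \<in> S" if "f' (u - a) \<noteq> 0" for u
    unfolding S_def using that by (intro image_eqI[of _ _ "u - a"]) (auto simp: f in_keys_iff)
  then have "{u. f' (u - a) \<noteq> 0} \<subseteq> S" by blast
  then have fin: "finite {u. f' (u - a) \<noteq> 0}" using S by (rule finite_subset)
  define h where "h = Abs_poly_mapping (\<lambda>u. f' (u - a))"
  have h: "Poly_Mapping.lookup h = (\<lambda>u. f' (u - a))"
    unfolding h_def using fin by (rule lookup_Abs_poly_mapping)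
  have sub: "Poly_Mapping.keys h \<subseteq> S" using memS by (auto simp: in_keys_iff h)
  have "laurent_eval h x = 0" if x: "x \<in> X" for x
  proof -
    have "laurent_eval h x = (\<Sum>u\<in>S. f' (u - a) * (\<Prod>i\<in>UNIV. (x $ i) powi (u $ i)))"
      using laurent_eval_superset[OF S sub] by (simp add: h)
    also have "\<dots> = (\<Sum>u\<in>Poly_Mapping.keys f. f' u * (\<Prod>i\<in>UNIV. (x $ i) powi ((u + a) $ i)))"
      unfolding S_def by (subst sum.reindex) (auto simp: inj_on_def)
    also have "\<dots> = laurent_eval f x * (\<Prod>i\<in>UNIV. (x $ i) powi (a $ i))"
      using X x by (subst monomial_add) (auto simp: laurent_eval_def f sum_distrib_right mult.assoc)
    also have "\<dots> = 0" using f(1) x by (simp add: vanishing_ideal_def)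
    finally show ?thesis .
  qed
  then have "h \<in> vanishing_ideal X" by (simp add: vanishing_ideal_def)
  then show ?thesis using h by (metis imageI)
qed

text \<open>The variables before N stand for the coordinates and their inverses, and variable N
  stands for 1.\<close>

lemma monomial_presentation_exists:
  "\<exists>N (\<phi> :: (nat \<Rightarrow>\<^sub>0 nat) \<Rightarrow> int ^ 'n::finite). (\<forall>m s. \<phi> (m + s) = \<phi> m + \<phi> s) \<and>
     (\<forall>d. \<phi> (Poly_Mapping.single N d) = 0) \<and> (\<forall>u. \<exists>d. \<exists>m\<in>Mon N d. \<phi> m = u)"
proof -
  define B :: "(int ^ 'n) set" where "B = range (\<lambda>i. axis i 1) \<union> range (\<lambda>i. axis i (- 1))"
  have "finite B" by (simp add: B_def)
  then obtain N and gen :: "nat \<Rightarrow> int ^ 'n" where gen: "B = gen ` {i. i < N}"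
    using finite_imp_nat_seg_image_inj_on by blast
  define \<phi> :: "(nat \<Rightarrow>\<^sub>0 nat) \<Rightarrow> int ^ 'n" where
    \<comment> \<open>The sum stops before N, so the homogenising variable contributes
      nothing.\<close>
    "\<phi> = (\<lambda>m. \<chi> j. \<Sum>i<N. int (Poly_Mapping.lookup m i) * gen i $ j)"
  have add: "\<phi> (m + s) = \<phi> m + \<phi> s" for m s
    by (simp add: \<phi>_def vec_eq_iff lookup_add sum.distrib algebra_simps)
  have single: "\<phi> (Poly_Mapping.single N d) = 0" for d
    by (simp add: \<phi>_def vec_eq_iff lookup_single)
  \<comment> \<open>The image of \<open>\<phi>\<close> on homogeneous monomials is a submonoid
    containing all signed unit vectors, hence everything.\<close>
  define R where "R = {u. \<exists>d. \<exists>m\<in>Mon N d. \<phi> m = u}"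
  have R0: "0 \<in> R" using single_Mon[of N 0] single[of 0] by (auto simp: R_def)
  have Radd: "u + v \<in> R" if "u \<in> R" "v \<in> R" for u v
    using that Mon_add add unfolding R_def by (smt (verit) mem_Collect_eq)
  have RB: "b \<in> R" if "b \<in> B" for b
  proof -
    obtain i where i: "i < N" "b = gen i" using \<open>b \<in> B\<close> gen by blast
    have "(\<Sum>k\<le>N. Poly_Mapping.lookup (Poly_Mapping.single i (1::nat)) k) = (\<Sum>k\<le>N. if k = i then 1 else 0)"
      by (intro sum.cong) (auto simp: lookup_single)
    then have "Poly_Mapping.single i 1 \<in> Mon N 1" using i by (simp add: Mon_def)
    moreover have "\<phi> (Poly_Mapping.single i 1) = b"
    proof -
      have "(\<Sum>k<N. int (Poly_Mapping.lookup (Poly_Mapping.single i 1) k) * gen k $ j) =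
          (\<Sum>k<N. if k = i then gen i $ j else 0)" for j
        by (intro sum.cong) (auto simp: lookup_single)
      then show ?thesis using i by (simp add: \<phi>_def vec_eq_iff)
    qed
    ultimately show ?thesis by (auto simp: R_def)
  qed
  have Raxis_nat: "axis j (c * int n) \<in> R" if "c = 1 \<or> c = - 1" for j c n
  proof (induction n)
    case 0
    have "axis j (c * int 0) = (0 :: int ^ 'n)" by (simp add: vec_eq_iff axis_def)
    with R0 show ?case by metis
  next
    case (Suc n)
    have "axis j c \<in> R" using that by (intro RB) (auto simp: B_def)
    then have "axis j c + axis j (c * int n) \<in> R" using Suc by (rule Radd)
    also have "axis j c + axis j (c * int n) = axis j (c * int (Suc n))"
      by (simp add: vec_eq_iff axis_def algebra_simps)
    finally show ?case .
  qed
  have Raxis: "axis j z \<in> R" for j z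
    using Raxis_nat[of 1 j "nat z"] Raxis_nat[of "- 1" j "nat (- z)"] by (cases "0 \<le> z") auto
  have "(\<Sum>j\<in>S. axis j (u $ j)) \<in> R" for S and u :: "int ^ 'n"
    by (induction S rule: infinite_finite_induct) (auto intro: R0 Radd Raxis)
  moreover have "u = (\<Sum>j\<in>UNIV. axis j (u $ j))" for u :: "int ^ 'n"
    by (simp add: vec_eq_iff axis_def if_distrib cong: if_cong)
  ultimately have "u \<in> R" for u by metis
  then show ?thesis using add single unfolding R_def by blast
qed

section \<open>Tropical hypersurfaces through strict minima\<close>

definition weight :: "real ^ 'n::finite \<Rightarrow> int ^ 'n \<Rightarrow> real" where
  "weight w u = w \<bullet> (\<chi> i. real_of_int (u $ i))"

lemma weight_add: "weight w (a + b) = weight w a + weight w b"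
proof -
  have "(\<chi> i. real_of_int ((a + b) $ i)) = (\<chi> i. real_of_int (a $ i)) + (\<chi> i. real_of_int (b $ i))"
    by (simp add: vec_eq_iff)
  then show ?thesis by (simp add: weight_def inner_add_right)
qed

context valued_field
begin

text \<open>The minimum is attained only once exactly when it is strict. The zero polynomial has no
  strict minimum, in accordance with its hypersurface being the whole space.\<close>

lemma mem_trop_hypersurface_iff:
  "w \<in> trop_hypersurface val f \<longleftrightarrow> \<not> (\<exists>u. strict_min (weight w) (Poly_Mapping.lookup f) u)"
proof (cases "f = 0")
  case True
  then show ?thesis by (simp add: trop_hypersurface_def strict_min_def)
next
  case False
  define t where "t = trop_term val f w"
  define M where "M = trop_poly val f w"
  have t: "val (Poly_Mapping.lookup f u) + weight w u = t u" for u
    by (simp add: t_def trop_term_def weight_def)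
  have smin: "strict_min (weight w) (Poly_Mapping.lookup f) u \<longleftrightarrow>
      u \<in> Poly_Mapping.keys f \<and> (\<forall>m\<in>Poly_Mapping.keys f. m \<noteq> u \<longrightarrow> t u < t m)" for u
    unfolding strict_min_def above_def t[symmetric] in_keys_iff Ball_def by (auto simp: algebra_simps)
  have M: "M = Min (t ` Poly_Mapping.keys f)" by (simp add: M_def trop_poly_def t_def)
  have ne: "t ` Poly_Mapping.keys f \<noteq> {}" using False by simp
  have le: "M \<le> t u" if "u \<in> Poly_Mapping.keys f" for u using that by (simp add: M)
  have "M \<in> t ` Poly_Mapping.keys f" unfolding M using ne by (intro Min_in) auto
  then obtain e where e: "e \<in> Poly_Mapping.keys f" "t e = M" by blast
  have "w \<in> trop_hypersurface val f \<longleftrightarrow>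
      (\<exists>u\<in>Poly_Mapping.keys f. \<exists>v\<in>Poly_Mapping.keys f. u \<noteq> v \<and> t u = M \<and> t v = M)"
    using False by (simp add: trop_hypersurface_def t_def M_def)
  also have "\<dots> \<longleftrightarrow> \<not> (\<exists>u. strict_min (weight w) (Poly_Mapping.lookup f) u)"
  proof
    assume "\<exists>u\<in>Poly_Mapping.keys f. \<exists>v\<in>Poly_Mapping.keys f. u \<noteq> v \<and> t u = M \<and> t v = M"
    then obtain u v where uv: "u \<in> Poly_Mapping.keys f" "v \<in> Poly_Mapping.keys f" "u \<noteq> v" "t u = M" "t v = M"
      by blast
    show "\<not> (\<exists>u. strict_min (weight w) (Poly_Mapping.lookup f) u)"
    proof
      assume "\<exists>z. strict_min (weight w) (Poly_Mapping.lookup f) z"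
      then obtain z where z: "z \<in> Poly_Mapping.keys f" "\<And>m. m \<in> Poly_Mapping.keys f \<Longrightarrow> m \<noteq> z \<Longrightarrow> t z < t m"
        using smin by blast
      show False using z(2)[of u] z(2)[of v] uv le[OF z(1)] by (cases "u = z") auto
    qed
  next
    assume "\<not> (\<exists>u. strict_min (weight w) (Poly_Mapping.lookup f) u)"
    then obtain m where m: "m \<in> Poly_Mapping.keys f" "m \<noteq> e" "\<not> t e < t m" using smin e by blast
    then have "t m = M" using le[OF m(1)] e by simp
    then show "\<exists>u\<in>Poly_Mapping.keys f. \<exists>v\<in>Poly_Mapping.keys f. u \<noteq> v \<and> t u = M \<and> t v = M"
      using e m by blast
  qed
  finally show ?thesis .
qed

lemma mem_tropical_variety_iff:
  "w \<in> tropical_variety val X \<longleftrightarrow>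
     (\<forall>f\<in>Poly_Mapping.lookup ` vanishing_ideal X. \<not> (\<exists>u. strict_min (weight w) f u))"
  by (auto simp: tropical_variety_def mem_trop_hypersurface_iff)

lemma finite_tropical_basis:
  fixes X :: "('k ^ 'n::finite) set"
  assumes X: "X \<subseteq> torus"
  shows "\<exists>C\<subseteq>vanishing_ideal X. finite C \<and> tropical_variety val X = (\<Inter>f\<in>C. trop_hypersurface val f)"
proof -
  define W where "W = Poly_Mapping.lookup ` vanishing_ideal X"
  obtain N and \<phi> :: "(nat \<Rightarrow>\<^sub>0 nat) \<Rightarrow> int ^ 'n" where \<phi>: "\<And>m s. \<phi> (m + s) = \<phi> m + \<phi> s"
      "\<And>d. \<phi> (Poly_Mapping.single N d) = 0" "\<And>u. \<exists>d. \<exists>m\<in>Mon N d. \<phi> m = u"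
    using monomial_presentation_exists by blast
  have W: "linear_closed W" "\<And>f a. f \<in> W \<Longrightarrow> (\<lambda>u. f (u - a)) \<in> W" "\<And>f. f \<in> W \<Longrightarrow> finite {u. f u \<noteq> 0}"
    using linear_closed_vanishing_ideal shift_vanishing_ideal[OF X] by (auto simp: W_def)
  obtain E where E: "finite E" "\<And>\<omega> f u. (\<forall>a b. \<omega> (a + b) = \<omega> a + \<omega> b) \<Longrightarrow> f \<in> W \<Longrightarrow> strict_min \<omega> f u \<Longrightarrow>
     (\<exists>g\<in>W. {v. g v \<noteq> 0} \<subseteq> E \<and> strict_min \<omega> g 0)"
    using degree_bound[OF W \<phi>] by metis
  \<comment> \<open>Restricting exponents to \<open>E\<close> makes the space finite-dimensional,
    and by \<open>E\<close> it still detects every weight at which some element of \<open>W\<close>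
    has a strict minimum.\<close>
  define V where "V = {g \<in> W. \<forall>v. g v \<noteq> 0 \<longrightarrow> v \<in> E}"
  have "linear_closed V"
    unfolding linear_closed_def
  proof (intro conjI ballI allI)
    show "(\<lambda>_. 0) \<in> V" using W(1) by (simp add: linear_closed_def V_def)
    fix f g c assume f: "f \<in> V" and g: "g \<in> V"
    then have "(\<lambda>u. f u + c * g u) \<in> W" using W(1) by (simp add: linear_closed_def V_def)
    moreover have "v \<in> E" if "f v + c * g v \<noteq> 0" for v
      using that f g unfolding V_def by (cases "f v = 0") auto
    ultimately show "(\<lambda>u. f u + c * g u) \<in> V" by (simp add: V_def)
  qed
  moreover have "m \<in> E" if "f \<in> V" "f m \<noteq> 0" for f m using that by (simp add: V_def)
  ultimately obtain C' where C': "C' \<subseteq> V" "finite C'"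
      "\<And>\<omega> u f. f \<in> V \<Longrightarrow> strict_min \<omega> f u \<Longrightarrow> \<exists>g\<in>C'. strict_min \<omega> g u"
    using finite_circuit_set[of V E] E(1) by metis
  have "C' \<subseteq> Poly_Mapping.lookup ` vanishing_ideal X" using C'(1) by (auto simp: V_def W_def)
  then obtain C where C: "C \<subseteq> vanishing_ideal X" "finite C" "C' = Poly_Mapping.lookup ` C"
    using finite_subset_image[OF C'(2)] by metis
  have "tropical_variety val X = (\<Inter>f\<in>C. trop_hypersurface val f)"
  proof
    show "tropical_variety val X \<subseteq> (\<Inter>f\<in>C. trop_hypersurface val f)"
      using C(1) by (auto simp: tropical_variety_def)
    show "(\<Inter>f\<in>C. trop_hypersurface val f) \<subseteq> tropical_variety val X"
    proof
      fix w assume w: "w \<in> (\<Inter>f\<in>C. trop_hypersurface val f)"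
      have "\<not> strict_min (weight w) f u" if fW: "f \<in> W" for f u
      proof
        assume "strict_min (weight w) f u"
        then obtain g where "g \<in> W" "{v. g v \<noteq> 0} \<subseteq> E" and g0: "strict_min (weight w) g 0"
          using E(2)[of "weight w" f u] fW weight_add by blast
        then have "g \<in> V" by (auto simp: V_def)
        then obtain g' where "g' \<in> C'" "strict_min (weight w) g' 0" using C'(3) g0 by blast
        then show False using w by (auto simp: C(3) mem_trop_hypersurface_iff)
      qed
      then show "w \<in> tropical_variety val X" by (auto simp: mem_tropical_variety_iff W_def)
    qed
  qed
  then show ?thesis using C by blast
qed

lemma value_group_uminus: "b \<in> value_group val \<Longrightarrow> - b \<in> value_group val"
  using val_divide[of 1] val_one unfolding value_group_def by (force intro: rev_image_eqI[of "1 / _"])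

lemma value_group_diff: "a \<noteq> 0 \<Longrightarrow> b \<noteq> 0 \<Longrightarrow> val a - val b \<in> value_group val"
  using val_divide[of a b] unfolding value_group_def by (intro image_eqI[of _ _ "a / b"]) auto

end

theorem corollary2p6:
  fixes val :: "'k::field \<Rightarrow> real" and X :: "('k ^ 'n::finite) set"
  assumes "nontrivial_valuation val"
    and "closure (value_group val) = UNIV"
    and "\<rat> \<subseteq> value_group val"
    and "\<exists>t. splitting val t"
    and "torus_subvariety X"
  shows "\<exists>\<C> :: (real ^ 'n) set set.
           finite \<C> \<and> rational_complex (value_group val) \<C> \<and> \<Union>\<C> = tropical_variety val X"
proof -
  interpret valued_field val
    using assms(1) by unfold_locales (simp add: nontrivial_valuation_def)
  have "X \<subseteq> torus" using assms(5) by (auto simp: torus_subvariety_def)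
  then obtain C where C: "finite C" "tropical_variety val X = (\<Inter>f\<in>C. trop_hypersurface val f)"
    using finite_tropical_basis by metis
  define \<iota> :: "int ^ 'n \<Rightarrow> real ^ 'n" where "\<iota> u = (\<chi> i. real_of_int (u $ i))" for u
  \<comment> \<open>The hyperplane on which the terms u and v of f have equal weight.\<close>
  define hyp where "hyp f = (\<lambda>(u, v). (\<iota> u - \<iota> v, val (Poly_Mapping.lookup f v) - val (Poly_Mapping.lookup f u)))"
    for f :: "('k, 'n) laurent_poly"
  define H where "H = (\<Union>f\<in>C. hyp f ` (Poly_Mapping.keys f \<times> Poly_Mapping.keys f))"
  have "finite H" using C(1) by (auto simp: H_def)
  moreover have "(\<forall>j. a $ j \<in> \<rat>) \<and> b \<in> value_group val" if "(a, b) \<in> H" for a b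
    using that value_group_diff by (auto simp: H_def hyp_def \<iota>_def in_keys_iff)
  moreover note value_group_uminus
  moreover have "cell H x \<subseteq> tropical_variety val X" if x: "x \<in> tropical_variety val X" for x
  proof
    fix y assume y: "y \<in> cell H x"
    have "\<not> strict_min (weight y) (Poly_Mapping.lookup f) u" if f: "f \<in> C" for f u
    proof
      assume min: "strict_min (weight y) (Poly_Mapping.lookup f) u"
      have "\<not> strict_min (weight x) (Poly_Mapping.lookup f) u"
        using x f by (auto simp: C(2) mem_trop_hypersurface_iff)
      \<comment> \<open>At x some other term m weighs at most as much as u. This is a weak
        inequality of the arrangement, so it carries over to y in the cell of x and contradicts the
        strict minimum there.\<close>
      with min obtain m where m: "m \<noteq> u" "Poly_Mapping.lookup f m \<noteq> 0"
          "val (Poly_Mapping.lookup f m) \<le> val (Poly_Mapping.lookup f u) + weight x u - weight x m"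
        by (auto simp: strict_min_def above_def not_less)
      have "hyp f (m, u) \<in> H"
        unfolding H_def using f m min
        by (intro UN_I[of f] imageI) (auto simp: in_keys_iff strict_min_def)
      moreover have "(\<iota> m - \<iota> u) \<bullet> z = weight z m - weight z u" for z
        by (simp add: \<iota>_def weight_def inner_diff_left inner_diff_right inner_commute)
      ultimately have "weight y m - weight y u \<le> val (Poly_Mapping.lookup f u) - val (Poly_Mapping.lookup f m)"
        using y m(3) unfolding cell_def hyp_def by fastforce
      moreover have "val (Poly_Mapping.lookup f u) + weight y u - weight y m < val (Poly_Mapping.lookup f m)"
        using min m(1,2) by (auto simp: strict_min_def above_def)
      ultimately show False by simp
    qed
    then show "y \<in> tropical_variety val X" by (auto simp: C(2) mem_trop_hypersurface_iff)
  qed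
  ultimately have "finite (cell H ` tropical_variety val X) \<and>
      rational_complex (value_group val) (cell H ` tropical_variety val X) \<and>
      \<Union>(cell H ` tropical_variety val X) = tropical_variety val X"
    by (rule arrangement_subcomplex)
  then show ?thesis by blast
qed

end
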